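(* Let $\theta(z) = \int_2^\infty \frac{\pi(t) - Li(t)}{t^{z+1}}\,dt$, which is a holomorphic function on $\{z \in \mathbb{C} : \operatorname{Re} z > 1\}$. If $\theta$ extends holomorphically to $\{z \in \mathbb{C} : \operatorname{Re} z > \tfrac{1}{2}\}$, then all nontrivial zeros of the Riemann zeta function $\varsigma$ lie on the vertical line $\{z \in \mathbb{C} : \operatorname{Re} z = \tfrac{1}{2}\}$.
   Context: Here $\pi(t)$ is the number of prime numbers in the segment $[2,t]$, and $Li(t) = \int_2^t \frac{ds}{\ln s}$. The function $\varsigma$ is the Riemann zeta function: $\varsigma(z) = \sum_{k=1}^\infty k^{-z}$ for $\operatorname{Re} z > 1$, extended holomorphically to $\mathbb{C} \setminus \{1\}$, with a simple pole at $z = 1$. The nontrivial zeros of $\varsigma$ are its zeros in the strip $\{0 < \operatorname{Re} z < 1\}$. That $\theta$ extends holomorphically to $\{\operatorname{Re} z > \tfrac12\}$ means that there is a holomorphic function on $\{\operatorname{Re} z > \tfrac12\}$ coinciding with $\theta$ on $\{\operatorname{Re} z > 1\}$. *)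

theory Defs
  imports
    "HOL-Complex_Analysis.Complex_Analysis"
    "HOL-Computational_Algebra.Primes"
begin

definition zeta_halfplane :: "real \<Rightarrow> complex set" where
  "zeta_halfplane c = {s. c < Re s}"

lemma open_zeta_halfplane: "open (zeta_halfplane c)"
  unfolding zeta_halfplane_def by (rule open_halfspace_Re_gt)

lemma connected_zeta_halfplane: "connected (zeta_halfplane c)"
  unfolding zeta_halfplane_def by (intro convex_connected convex_halfspace_Re_gt)

lemma holomorphic_suminf_halfplane:
  fixes f :: "nat \<Rightarrow> complex \<Rightarrow> complex"
  assumes hol: "\<And>n. f n holomorphic_on zeta_halfplane c"
    and bnd: "\<And>a b. c < a \<Longrightarrow> \<exists>M. summable M \<and> (\<forall>n s. a \<le> Re s \<and> norm s \<le> b \<longrightarrow> norm (f n s) \<le> M n)"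
  shows "(\<lambda>s. \<Sum>n. f n s) holomorphic_on zeta_halfplane c"
proof (rule holomorphic_uniform_sequence[where f = "\<lambda>N s. \<Sum>n<N. f n s"])
  show "open (zeta_halfplane c)" by (rule open_zeta_halfplane)
  show "(\<lambda>s. \<Sum>n<N. f n s) holomorphic_on zeta_halfplane c" for N
    by (intro holomorphic_intros hol)
  fix z assume "z \<in> zeta_halfplane c"
  then have z: "c < Re z" by (simp add: zeta_halfplane_def)
  define d where "d = (Re z - c) / 2"
  have d: "d > 0" "c < Re z - d" using z by (auto simp: d_def field_simps)
  obtain M where M: "summable M"
    and Mb: "\<And>n s. Re z - d \<le> Re s \<and> norm s \<le> norm z + d \<Longrightarrow> norm (f n s) \<le> M n"
    using bnd[OF d(2), of "norm z + d"] by blast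
  have re: "Re z - d \<le> Re s \<and> norm s \<le> norm z + d" if "s \<in> cball z d" for s
  proof -
    have *: "norm (z - s) \<le> d" using that by (simp add: dist_norm)
    have "\<bar>Re (z - s)\<bar> \<le> norm (z - s)" by (rule abs_Re_le_cmod)
    moreover have "norm s \<le> norm z + norm (z - s)" by (metis norm_minus_commute norm_triangle_sub)
    ultimately show ?thesis using * by auto
  qed
  have "cball z d \<subseteq> zeta_halfplane c"
    using re d(2) by (fastforce simp: zeta_halfplane_def)
  moreover have "uniform_limit (cball z d) (\<lambda>N s. \<Sum>n<N. f n s) (\<lambda>s. \<Sum>n. f n s) sequentially"
    by (rule Weierstrass_m_test[OF _ M]) (use re Mb in blast)
  ultimately show "\<exists>d>0. cball z d \<subseteq> zeta_halfplane c \<and>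
      uniform_limit (cball z d) (\<lambda>N s. \<Sum>n<N. f n s) (\<lambda>s. \<Sum>n. f n s) sequentially"
    using d(1) by blast
qed

definition zeta_series :: "complex \<Rightarrow> complex" where
  "zeta_series s = (\<Sum>n. of_nat (Suc n) powr (- s))"

lemma norm_Suc_powr: "norm (of_nat (Suc n) powr (s::complex)) = real (Suc n) powr Re s"
  by (subst norm_powr_real_powr) auto

lemma summable_Suc_powr: "x < -1 \<Longrightarrow> summable (\<lambda>n. real (Suc n) powr x)"
  using summable_real_powr_iff[of x] by (subst summable_Suc_iff[of "\<lambda>n. real n powr x"]) simp

lemma summable_zeta_series: "1 < Re s \<Longrightarrow> summable (\<lambda>n. of_nat (Suc n) powr (- s) :: complex)"
  by (rule summable_norm_cancel) (use summable_Suc_powr[of "- Re s"] in \<open>simp only: norm_Suc_powr, simp\<close>)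

lemma holomorphic_zeta_series: "zeta_series holomorphic_on zeta_halfplane 1"
  unfolding zeta_series_def[abs_def]
proof (rule holomorphic_suminf_halfplane)
  show "(\<lambda>s. of_nat (Suc n) powr (- s)) holomorphic_on zeta_halfplane 1" for n
    by (intro holomorphic_intros)
  fix a b :: real assume a: "1 < a"
  show "\<exists>M. summable M \<and> (\<forall>n s. a \<le> Re s \<and> norm s \<le> b \<longrightarrow> norm (of_nat (Suc n) powr - s :: complex) \<le> M n)"
  proof (intro exI conjI allI impI)
    show "summable (\<lambda>n. real (Suc n) powr - a)" using a by (intro summable_Suc_powr) auto
  next
    fix n and s :: complex assume "a \<le> Re s \<and> norm s \<le> b"
    then show "norm (of_nat (Suc n) powr - s :: complex) \<le> real (Suc n) powr - a"
      unfolding norm_Suc_powr by (intro powr_mono) auto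
  qed
qed

(* Taylor expansion of x powr a at n, with increment 1; zeta_ff is the falling factorial *)
definition zeta_ff :: "nat \<Rightarrow> complex \<Rightarrow> complex" where
  "zeta_ff i a = (\<Prod>j<i. a - of_nat j)"

definition zeta_rem :: "nat \<Rightarrow> nat \<Rightarrow> complex \<Rightarrow> complex" where
  "zeta_rem K n s = of_nat (Suc (Suc n)) powr (1 - s)
     - (\<Sum>i\<le>K. zeta_ff i (1 - s) * of_nat (Suc n) powr (1 - s - of_nat i) / fact i)"

lemma holomorphic_zeta_ff [holomorphic_intros]:
  "f holomorphic_on A \<Longrightarrow> (\<lambda>s. zeta_ff i (f s)) holomorphic_on A"
  unfolding zeta_ff_def by (intro holomorphic_intros)

lemma norm_zeta_ff: "norm (zeta_ff i a) \<le> (norm a + real i) ^ i"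
proof -
  have "norm (zeta_ff i a) = (\<Prod>j<i. norm (a - of_nat j))"
    unfolding zeta_ff_def by (simp add: prod_norm)
  also have "\<dots> \<le> (\<Prod>j<i. norm a + real i)"
  proof (intro prod_mono conjI)
    fix j assume "j \<in> {..<i}"
    then show "norm (a - of_nat j) \<le> norm a + real i"
      using norm_triangle_ineq4[of a "of_nat j"] by simp
  qed auto
  finally show ?thesis by simp
qed

lemma norm_zeta_rem:
  assumes "- real K \<le> Re s"
  shows "norm (zeta_rem K n s) \<le> (1 + norm s + real (Suc K)) ^ Suc K * real (Suc n) powr (- Re s - real K)"
proof -
  define a where "a = 1 - s"
  define S where "S = closed_segment (of_nat (Suc n)) (of_nat (Suc (Suc n)) :: complex)"
  define F where "F = (\<lambda>i x. zeta_ff i a * x powr (a - of_nat i))"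
  define B where "B = norm (zeta_ff (Suc K) a) * real (Suc n) powr (- Re s - real K)"
  have S: "\<exists>t. x = of_real t \<and> real (Suc n) \<le> t" if x: "x \<in> S" for x
  proof -
    from x obtain u where u: "0 \<le> u" "u \<le> 1"
      "x = (1 - u) *\<^sub>R of_nat (Suc n) + u *\<^sub>R of_nat (Suc (Suc n))"
      unfolding S_def closed_segment_def by blast
    have "x = of_real (real (Suc n) + u)"
      unfolding u(3) by (simp add: scaleR_conv_of_real algebra_simps)
    with u(1) show ?thesis by (intro exI[of _ "real (Suc n) + u"]) simp
  qed
  have "norm (F 0 (of_nat (Suc (Suc n))) - (\<Sum>i\<le>K. F i (of_nat (Suc n)) * (of_nat (Suc (Suc n)) - of_nat (Suc n)) ^ i / fact i))
      \<le> B * norm (of_nat (Suc (Suc n)) - of_nat (Suc n) :: complex) ^ Suc K / fact K"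
  proof (rule field_Taylor[where S = S])
    show "convex S" by (simp add: S_def)
    show "of_nat (Suc n) \<in> S" "of_nat (Suc (Suc n)) \<in> S" by (simp_all add: S_def)
  next
    fix i and x :: complex assume "x \<in> S"
    then obtain t where t: "x = of_real t" "real (Suc n) \<le> t" using S by blast
    then have "x \<notin> \<real>\<^sub>\<le>\<^sub>0" by (auto simp: complex_nonpos_Reals_iff)
    then have "(F i has_field_derivative zeta_ff i a * ((a - of_nat i) * x powr (a - of_nat i - 1))) (at x within S)"
      unfolding F_def by (auto intro!: derivative_eq_intros)
    then show "(F i has_field_derivative F (Suc i) x) (at x within S)"
      by (simp add: F_def zeta_ff_def algebra_simps)
  next
    fix x :: complex assume "x \<in> S"
    then obtain t where t: "x = of_real t" "real (Suc n) \<le> t" using S by blast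
    have "norm (x powr (a - of_nat (Suc K))) = t powr (Re (a - of_nat (Suc K)))"
      using t by (subst norm_powr_real_powr) auto
    also have "Re (a - of_nat (Suc K)) = - Re s - real K" by (simp add: a_def)
    also have "t powr (- Re s - real K) \<le> real (Suc n) powr (- Re s - real K)"
      using t assms by (intro powr_mono2') auto
    finally show "norm (F (Suc K) x) \<le> B"
      unfolding F_def B_def norm_mult by (intro mult_left_mono) auto
  qed
  also have "F 0 (of_nat (Suc (Suc n))) - (\<Sum>i\<le>K. F i (of_nat (Suc n)) * (of_nat (Suc (Suc n)) - of_nat (Suc n)) ^ i / fact i)
      = zeta_rem K n s"
    by (simp add: zeta_rem_def F_def a_def zeta_ff_def)
  also have "B * norm (of_nat (Suc (Suc n)) - of_nat (Suc n) :: complex) ^ Suc K / fact K \<le> B * 1"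
  proof -
    have "B \<ge> 0" by (simp add: B_def)
    then have "B / fact K \<le> B / 1" by (intro divide_left_mono) auto
    then show ?thesis by simp
  qed
  also have "B * 1 \<le> (1 + norm s + real (Suc K)) ^ Suc K * real (Suc n) powr (- Re s - real K)"
  proof -
    have "norm a \<le> 1 + norm s" unfolding a_def using norm_triangle_ineq4[of 1 s] by simp
    then have "(norm a + real (Suc K)) ^ Suc K \<le> (1 + norm s + real (Suc K)) ^ Suc K"
      by (intro power_mono) auto
    with norm_zeta_ff[of "Suc K" a] show ?thesis
      unfolding B_def mult_1_right by (intro mult_right_mono) auto
  qed
  finally show ?thesis .
qed

lemma holomorphic_zeta_rem: "(\<lambda>s. \<Sum>n. zeta_rem K n s) holomorphic_on zeta_halfplane (1 - real K)"
proof (rule holomorphic_suminf_halfplane)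
  show "zeta_rem K n holomorphic_on zeta_halfplane (1 - real K)" for n
    unfolding zeta_rem_def[abs_def] by (intro holomorphic_intros) auto
  fix a b :: real assume a: "1 - real K < a"
  let ?C = "(1 + \<bar>b\<bar> + real (Suc K)) ^ Suc K"
  show "\<exists>M. summable M \<and> (\<forall>n s. a \<le> Re s \<and> norm s \<le> b \<longrightarrow> norm (zeta_rem K n s) \<le> M n)"
  proof (intro exI conjI allI impI)
    show "summable (\<lambda>n. ?C * real (Suc n) powr (- a - real K))"
      using a by (intro summable_mult summable_Suc_powr) auto
  next
    fix n and s :: complex assume s: "a \<le> Re s \<and> norm s \<le> b"
    have "norm (zeta_rem K n s) \<le> (1 + norm s + real (Suc K)) ^ Suc K * real (Suc n) powr (- Re s - real K)"
      using a s by (intro norm_zeta_rem) auto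
    also have "\<dots> \<le> ?C * real (Suc n) powr (- a - real K)"
      using s by (intro mult_mono power_mono powr_mono) auto
    finally show "norm (zeta_rem K n s) \<le> ?C * real (Suc n) powr (- a - real K)" .
  qed
qed

lemma zeta_series_recurrence:
  assumes s: "1 < Re s"
  shows "(s - 1) * zeta_series s = 1
    - (\<Sum>i\<in>{2..Suc m}. zeta_ff (i - 1) (1 - s) / fact i * ((s + of_nat i - 2) * zeta_series (s + of_nat i - 1)))
    + (\<Sum>n. zeta_rem (Suc m) n s)"
proof -
  define a where "a = 1 - s"
  define Z where "Z = (\<lambda>i::nat. zeta_ff i a / fact i * zeta_series (s + of_nat i - 1))"
  define D where "D = (\<lambda>n. of_nat (Suc (Suc n)) powr a - of_nat (Suc n) powr a)"
  have lim: "(\<lambda>n. of_nat (Suc n) powr a) \<longlonglongrightarrow> 0"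
  proof (rule tendsto_norm_zero_cancel)
    have "(\<lambda>n. real n powr (1 - Re s)) \<longlonglongrightarrow> 0"
      using s by (intro tendsto_neg_powr filterlim_real_sequentially) auto
    then have "(\<lambda>n. real (Suc n) powr (1 - Re s)) \<longlonglongrightarrow> 0" by (rule LIMSEQ_Suc)
    then show "(\<lambda>n. norm (of_nat (Suc n) powr a)) \<longlonglongrightarrow> 0"
      by (simp only: norm_Suc_powr a_def minus_complex.simps one_complex.simps)
  qed
  have D: "D sums (- 1)"
    using telescope_sums[OF lim] by (simp add: D_def)
  have Zs: "(\<lambda>n. zeta_ff i a / fact i * of_nat (Suc n) powr (a - of_nat i)) sums Z i" if "i \<ge> 1" for i
  proof -
    have "1 < Re (s + of_nat i - 1)" using s that by (simp add: of_nat_diff)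
    from summable_sums[OF summable_zeta_series[OF this]]
    have "(\<lambda>n. of_nat (Suc n) powr (a - of_nat i)) sums zeta_series (s + of_nat i - 1)"
      unfolding zeta_series_def a_def by (simp add: algebra_simps)
    then show ?thesis unfolding Z_def by (rule sums_mult)
  qed
  have R: "zeta_rem (Suc m) n s = D n - (\<Sum>i\<in>{1..Suc m}. zeta_ff i a / fact i * of_nat (Suc n) powr (a - of_nat i))" for n
  proof -
    have "{..Suc m} = insert 0 {1..Suc m}" by auto
    then show ?thesis
      unfolding zeta_rem_def D_def a_def by (simp add: zeta_ff_def)
  qed
  have "(\<lambda>n. zeta_rem (Suc m) n s) sums (- 1 - (\<Sum>i\<in>{1..Suc m}. Z i))"
    unfolding R by (intro sums_diff D sums_sum Zs) auto
  then have 1: "(\<Sum>n. zeta_rem (Suc m) n s) = - 1 - (\<Sum>i\<in>{1..Suc m}. Z i)"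
    by (simp add: sums_iff)
  have "{1..Suc m} = insert 1 {2..Suc m}" by auto
  then have 2: "(\<Sum>i\<in>{1..Suc m}. Z i) = Z 1 + (\<Sum>i\<in>{2..Suc m}. Z i)" by simp
  have 3: "Z 1 = - ((s - 1) * zeta_series s)"
    by (simp add: Z_def zeta_ff_def a_def algebra_simps)
  have 4: "Z i = - (zeta_ff (i - 1) (1 - s) / fact i * ((s + of_nat i - 2) * zeta_series (s + of_nat i - 1)))"
    if "i \<in> {2..Suc m}" for i
  proof -
    from that have "i \<noteq> 0" by auto
    then obtain k where k: "i = Suc k" by (cases i) auto
    have ff: "zeta_ff i a = - (zeta_ff (i - 1) a * (s + of_nat i - 2))"
      by (simp add: k zeta_ff_def a_def algebra_simps)
    show ?thesis unfolding Z_def ff by (simp add: a_def)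
  qed
  have 5: "(\<Sum>i\<in>{2..Suc m}. Z i) = - (\<Sum>i\<in>{2..Suc m}. zeta_ff (i - 1) (1 - s) / fact i * ((s + of_nat i - 2) * zeta_series (s + of_nat i - 1)))"
    unfolding sum_negf[symmetric] by (rule sum.cong[OF refl 4])
  show ?thesis unfolding 1 2 3 5 by simp
qed

lemma zeta_series_extends_halfplane:
  "\<exists>g. g holomorphic_on zeta_halfplane (1 - real m) \<and> (\<forall>s. 1 < Re s \<longrightarrow> g s = (s - 1) * zeta_series s)"
proof (induction m)
  case 0
  have "(\<lambda>s. (s - 1) * zeta_series s) holomorphic_on zeta_halfplane 1"
    by (intro holomorphic_intros holomorphic_zeta_series)
  then show ?case by auto
next
  case (Suc m)
  then obtain g where g: "g holomorphic_on zeta_halfplane (1 - real m)"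
    "\<And>s. 1 < Re s \<Longrightarrow> g s = (s - 1) * zeta_series s" by blast
  define h where "h = (\<lambda>s. 1
    - (\<Sum>i\<in>{2..Suc m}. zeta_ff (i - 1) (1 - s) / fact i * g (s + of_nat i - 1))
    + (\<Sum>n. zeta_rem (Suc m) n s))"
  have gi: "(\<lambda>s. g (s + of_nat i - 1)) holomorphic_on zeta_halfplane (1 - real (Suc m))"
    if "i \<in> {2..Suc m}" for i
  proof -
    have "g \<circ> (\<lambda>s. s + of_nat i - 1) holomorphic_on zeta_halfplane (1 - real (Suc m))"
      using that by (intro holomorphic_on_compose_gen[OF _ g(1)] holomorphic_intros)
        (auto simp: zeta_halfplane_def)
    then show ?thesis by (simp add: o_def)
  qed
  have "h holomorphic_on zeta_halfplane (1 - real (Suc m))"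
    unfolding h_def by (intro holomorphic_intros gi holomorphic_zeta_rem) auto
  moreover have "h s = (s - 1) * zeta_series s" if s: "1 < Re s" for s
  proof -
    have *: "g (s + of_nat i - 1) = (s + of_nat i - 2) * zeta_series (s + of_nat i - 1)"
      if "i \<in> {2..Suc m}" for i
      using that s by (subst g(2)) (auto simp: algebra_simps)
    have "(\<Sum>i\<in>{2..Suc m}. zeta_ff (i - 1) (1 - s) / fact i * g (s + of_nat i - 1))
        = (\<Sum>i\<in>{2..Suc m}. zeta_ff (i - 1) (1 - s) / fact i * ((s + of_nat i - 2) * zeta_series (s + of_nat i - 1)))"
      by (intro sum.cong refl) (simp only: *)
    then show ?thesis unfolding h_def zeta_series_recurrence[OF s, of m] by simp
  qed
  ultimately show ?case by blast
qed

lemma zeta_extension_exists: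
  "\<exists>f. f holomorphic_on - {1} \<and> (\<forall>s. 1 < Re s \<longrightarrow> f s = zeta_series s)"
proof -
  obtain g where gh: "\<And>m. g m holomorphic_on zeta_halfplane (1 - real m)"
    and ge: "\<And>m s. 1 < Re s \<Longrightarrow> g m s = (s - 1) * zeta_series s"
    using zeta_series_extends_halfplane by metis
  have eq: "g m s = g k s" if "m \<le> k" "s \<in> zeta_halfplane (1 - real m)" for m k s
  proof (rule analytic_continuation_open[where f = "g m" and g = "g k" and s = "zeta_halfplane 1" and s' = "zeta_halfplane (1 - real m)"])
    have "(2::complex) \<in> zeta_halfplane 1" by (simp add: zeta_halfplane_def)
    then show "zeta_halfplane 1 \<noteq> {}" by blast
    show "g k holomorphic_on zeta_halfplane (1 - real m)"
      by (rule holomorphic_on_subset[OF gh]) (use that in \<open>auto simp: zeta_halfplane_def\<close>)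
    show "zeta_halfplane 1 \<subseteq> zeta_halfplane (1 - real m)" by (auto simp: zeta_halfplane_def)
    show "g m z = g k z" if "z \<in> zeta_halfplane 1" for z
      using that ge by (simp add: zeta_halfplane_def)
  qed (use that gh open_zeta_halfplane connected_zeta_halfplane in auto)
  define N where "N = (\<lambda>s. nat \<lceil>1 - Re s\<rceil> + 1)"
  have N: "s \<in> zeta_halfplane (1 - real (N s))" for s
    unfolding zeta_halfplane_def N_def by simp linarith
  define G where "G = (\<lambda>s. g (N s) s)"
  have Geq: "G s = g m s" if "s \<in> zeta_halfplane (1 - real m)" for m s
    using eq[of m "N s" s] eq[of "N s" m s] that N[of s] unfolding G_def by (metis nle_le)
  have "G field_differentiable at s" for s
  proof -
    have "g (N s) field_differentiable at s"
      using holomorphic_on_imp_differentiable_at[OF gh open_zeta_halfplane N] .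
    moreover have "eventually (\<lambda>w. w \<in> zeta_halfplane (1 - real (N s))) (nhds s)"
      by (rule eventually_nhds_in_open[OF open_zeta_halfplane N])
    then have "eventually (\<lambda>w. G w = g (N s) w) (nhds s)"
      by eventually_elim (rule Geq)
    ultimately show ?thesis
      unfolding field_differentiable_def by (metis DERIV_cong_ev)
  qed
  then have "G holomorphic_on A" for A
    by (simp add: holomorphic_on_def field_differentiable_at_within)
  then have "(\<lambda>s. G s / (s - 1)) holomorphic_on - {1}"
    by (intro holomorphic_intros) auto
  moreover have "G s / (s - 1) = zeta_series s" if "1 < Re s" for s
  proof -
    have "s \<noteq> 1" using that by auto
    then show ?thesis using ge[OF that] by (simp add: G_def)
  qed
  ultimately show ?thesis by blast
qed

(* The value at the pole 1 is unspecified. *)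
definition riemann_zeta :: "complex \<Rightarrow> complex" where
  "riemann_zeta = (SOME f. f holomorphic_on - {1} \<and>
     (\<forall>z. 1 < Re z \<longrightarrow> f z = (\<Sum>n. of_nat (Suc n) powr (- z))))"

lemma riemann_zeta_holomorphic: "riemann_zeta holomorphic_on - {1}"
  and riemann_zeta_eq_series: "1 < Re z \<Longrightarrow> riemann_zeta z = (\<Sum>n. of_nat (Suc n) powr (- z))"
  using someI_ex[OF zeta_extension_exists[unfolded zeta_series_def]]
  unfolding riemann_zeta_def by blast+

lemma riemann_zeta_unique:
  assumes f: "f holomorphic_on - {1}" "\<And>z. 1 < Re z \<Longrightarrow> f z = (\<Sum>n. of_nat (Suc n) powr (- z))"
    and z: "z \<noteq> 1"
  shows "riemann_zeta z = f z"
proof (rule analytic_continuation_open[where f = riemann_zeta and g = f and s = "zeta_halfplane 1" and s' = "- {1}"])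
  have "(2::complex) \<in> zeta_halfplane 1" by (simp add: zeta_halfplane_def)
  then show "zeta_halfplane 1 \<noteq> {}" by blast
  show "connected (- {1::complex})"
    by (rule connected_punctured_universe) simp
  show "zeta_halfplane 1 \<subseteq> - {1}" by (auto simp: zeta_halfplane_def)
  show "riemann_zeta z = f z" if "z \<in> zeta_halfplane 1" for z
    using that riemann_zeta_eq_series f(2) by (simp add: zeta_halfplane_def)
qed (use open_zeta_halfplane f(1) z riemann_zeta_holomorphic in auto)

definition nontrivial_zeta_zero :: "complex \<Rightarrow> bool" where
  "nontrivial_zeta_zero z \<longleftrightarrow> 0 < Re z \<and> Re z < 1 \<and> riemann_zeta z = 0"

definition prime_pi :: "real \<Rightarrow> real" where
  "prime_pi t = real (card {p::nat. prime p \<and> real p \<le> t})"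

definition Li :: "real \<Rightarrow> real" where
  "Li t = (LINT s:{2..t}|lborel. 1 / ln s)"

definition theta :: "complex \<Rightarrow> complex" where
  "theta z = (LINT t:{2..}|lborel. complex_of_real (prime_pi t - Li t) / complex_of_real t powr (z + 1))"

lemma finite_primes_le: "finite {p::nat. prime p \<and> real p \<le> t}"
proof (rule finite_subset)
  show "{p::nat. prime p \<and> real p \<le> t} \<subseteq> {1..nat \<lfloor>t\<rfloor>}"
    by (auto simp: le_nat_floor dest: prime_gt_0_nat)
qed simp

lemma prime_pi_bounds:
  assumes "0 \<le> t" shows "0 \<le> prime_pi t" "prime_pi t \<le> t"
proof -
  have "card {p::nat. prime p \<and> real p \<le> t} \<le> card {1..nat \<lfloor>t\<rfloor>}"
    by (rule card_mono) (auto simp: le_nat_floor dest: prime_gt_0_nat)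
  then show "prime_pi t \<le> t" using assms unfolding prime_pi_def by simp linarith
qed (simp add: prime_pi_def)

lemma mono_prime_pi: "mono prime_pi"
  unfolding prime_pi_def by (intro monoI of_nat_mono card_mono finite_primes_le) auto

lemma set_integrable_inverse_ln: "set_integrable lborel {2..t} (\<lambda>s::real. 1 / ln s)"
  by (rule borel_integrable_atLeastAtMost') (auto intro!: continuous_intros)

lemma mono_Li: "mono Li"
proof (rule monoI)
  fix x y :: real assume "x \<le> y"
  then show "Li x \<le> Li y"
    unfolding Li_def set_lebesgue_integral_def
    by (intro integral_mono set_integrable_inverse_ln[unfolded set_integrable_def])
       (auto simp: indicator_def)
qed

lemma Li_bounds:
  assumes "0 \<le> t" shows "0 \<le> Li t" "Li t \<le> t / ln 2"
proof -
  show "0 \<le> Li t"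
    unfolding Li_def set_lebesgue_integral_def by (rule Bochner_Integration.integral_nonneg) (auto simp: indicator_def)
  have "Li t \<le> (LINT s:{2..t}|lborel. 1 / ln 2)"
    unfolding Li_def
    by (rule set_integral_mono[OF set_integrable_inverse_ln])
       (auto intro!: borel_integrable_atLeastAtMost' divide_left_mono)
  also have "\<dots> = measure lborel {2..t} * (1 / ln 2)"
    by (subst set_integral_const) (auto simp: emeasure_lborel_Icc_eq)
  also have "\<dots> \<le> t * (1 / ln 2)"
    using assms by (intro mult_right_mono) (cases "2 \<le> t"; simp)+
  finally show "Li t \<le> t / ln 2" by simp
qed

lemma borel_measurable_prime_pi [measurable]: "prime_pi \<in> borel_measurable borel"
  by (rule borel_measurable_mono[OF mono_prime_pi])

lemma borel_measurable_Li [measurable]: "Li \<in> borel_measurable borel"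
  by (rule borel_measurable_mono[OF mono_Li])

definition theta_integrand :: "complex \<Rightarrow> real \<Rightarrow> complex" where
  "theta_integrand z t = indicator {2..} t *\<^sub>R
     (complex_of_real (prime_pi t - Li t) / complex_of_real t powr (z + 1))"

lemma borel_measurable_theta_integrand [measurable]: "theta_integrand z \<in> borel_measurable borel"
  unfolding theta_integrand_def[abs_def] powr_def by measurable

lemma norm_theta_integrand:
  assumes "a \<le> Re z"
  shows "norm (theta_integrand z t) \<le> (1 + 1 / ln 2) * (indicator {2..} t * t powr - a)"
proof (cases "t \<ge> 2")
  case True
  have "\<bar>prime_pi t - Li t\<bar> \<le> t + t / ln 2"
    using prime_pi_bounds[of t] Li_bounds[of t] True by auto
  also have "\<dots> = (1 + 1 / ln 2) * t" by (simp add: field_simps)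
  finally have "\<bar>prime_pi t - Li t\<bar> / t powr (Re z + 1) \<le> (1 + 1 / ln 2) * t / t powr (Re z + 1)"
    by (intro divide_right_mono) auto
  also have "\<dots> = (1 + 1 / ln 2) * t powr - Re z"
    using True by (simp add: powr_add powr_minus field_simps)
  also have "\<dots> \<le> (1 + 1 / ln 2) * t powr - a"
    using True assms by (intro mult_left_mono powr_mono) auto
  finally show ?thesis
    using True by (simp add: theta_integrand_def norm_divide norm_powr_real_powr del: of_real_diff)
qed (simp add: theta_integrand_def)

lemma integrable_theta_majorant:
  assumes "1 < a" shows "integrable lborel (\<lambda>t::real. indicator {2..} t * t powr - a)"
proof -
  have "(\<lambda>t::real. t powr - a) integrable_on {2..}"
    using has_integral_powr_to_inf[of "- a" 2] assms by auto
  then have "(\<lambda>t::real. t powr - a) absolutely_integrable_on {2..}"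
    by (subst absolutely_integrable_on_iff_nonneg) auto
  then show ?thesis
    unfolding set_integrable_def by (subst (asm) integrable_completion) auto
qed

lemma integrable_theta_integrand:
  assumes "1 < Re z" shows "integrable lborel (theta_integrand z)"
proof (rule Bochner_Integration.integrable_bound)
  show "integrable lborel (\<lambda>t. (1 + 1 / ln 2) * (indicator {2..} t * t powr - Re z))"
    by (intro integrable_mult_right integrable_theta_majorant assms)
  show "AE t in lborel. norm (theta_integrand z t) \<le> norm ((1 + 1 / ln 2) * (indicator {2..} t * t powr - Re z))"
    using norm_theta_integrand[of "Re z" z] by (intro AE_I2) (simp add: order_trans[OF _ abs_ge_self])
qed simp

lemma theta_set_integrable:
  "1 < Re z \<Longrightarrow> set_integrable lborel {2..}
     (\<lambda>t. complex_of_real (prime_pi t - Li t) / complex_of_real t powr (z + 1))"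
  using integrable_theta_integrand[of z] unfolding set_integrable_def theta_integrand_def[abs_def] .

lemma theta_has_field_derivative:
  assumes z: "1 < Re z"
  shows "(theta has_field_derivative (LINT t|lborel. - complex_of_real (ln t) * theta_integrand z t)) (at z)"
proof -
  define a where "a = (1 + Re z) / 2"
  define b where "b = (1 + a) / 2"
  have ab: "1 < b" "b < a" "a < Re z" using z by (auto simp: a_def b_def field_simps)
  define K where "K = (1 + 1 / ln 2) / (a - b)"
  define w where "w = (\<lambda>t::real. K * (indicator {2..} t * t powr - b))"
  have w: "integrable lborel w"
    unfolding w_def by (intro integrable_mult_right integrable_theta_majorant ab)
  have der: "((\<lambda>y. theta_integrand y t) has_field_derivative - complex_of_real (ln t) * theta_integrand y t) (at y within S)"
    for y t S
  proof (cases "t \<ge> 2")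
    case True
    have eq: "(\<lambda>y. theta_integrand y t)
        = (\<lambda>y. complex_of_real (prime_pi t - Li t) * complex_of_real t powr (- y - 1))"
      using True by (simp add: theta_integrand_def powr_minus_divide[of _ "y + 1" for y, simplified])
    have g: "((\<lambda>y. - y - 1) has_field_derivative - 1) (at y within S)"
      by (auto intro!: derivative_eq_intros)
    have "((\<lambda>y. complex_of_real (prime_pi t - Li t) * complex_of_real t powr (- y - 1)) has_field_derivative
        complex_of_real (prime_pi t - Li t) * (Ln (complex_of_real t) * complex_of_real t powr (- y - 1) * (- 1))) (at y within S)"
      by (intro DERIV_cmult DERIV_chain2[OF has_field_derivative_powr_right g]) (use True in auto)
    moreover have "Ln (complex_of_real t) = complex_of_real (ln t)"
      using True by (simp add: Ln_of_real)
    ultimately show ?thesis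
      using fun_cong[OF eq, of y] unfolding eq by (simp add: mult_ac del: of_real_diff)
  next
    case False
    then show ?thesis by (simp add: theta_integrand_def)
  qed
  have lnb: "norm (- complex_of_real (ln t) * theta_integrand y t) \<le> w t" if y: "a \<le> Re y" for y t
  proof (cases "t \<ge> 2")
    case True
    have "norm (- complex_of_real (ln t) * theta_integrand y t) = ln t * norm (theta_integrand y t)"
      using True by (simp add: norm_mult)
    also have "\<dots> \<le> (t powr (a - b) / (a - b)) * ((1 + 1 / ln 2) * (indicator {2..} t * t powr - a))"
      using True ab y by (intro mult_mono ln_powr_bound norm_theta_integrand) auto
    also have "\<dots> = w t"
    proof -
      have "t powr - b = t powr (a - b) * t powr - a" by (simp flip: powr_add)
      then show ?thesis using True by (simp add: w_def K_def)
    qed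
    finally show ?thesis .
  qed (simp add: theta_integrand_def w_def)
  have theta: "theta y = (LINT t|lborel. theta_integrand y t)" for y
    by (simp add: theta_def set_lebesgue_integral_def theta_integrand_def)
  have "((\<lambda>y. (theta y - theta z) / (y - z)) \<longlongrightarrow> (LINT t|lborel. - complex_of_real (ln t) * theta_integrand z t)) (at z)"
    unfolding tendsto_at_iff_sequentially
  proof (intro allI impI)
    fix X :: "nat \<Rightarrow> complex" assume X: "\<forall>i. X i \<in> UNIV - {z}" "X \<longlonglongrightarrow> z"
    have "open {y. a < Re y}" by (rule open_halfspace_Re_gt)
    then have "eventually (\<lambda>i. X i \<in> {y. a < Re y}) sequentially"
      using X(2) ab by (intro topological_tendstoD) auto
    then obtain N where N: "\<And>i. i \<ge> N \<Longrightarrow> a < Re (X i)"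
      by (auto simp: eventually_sequentially)
    define Y where "Y = (\<lambda>i. X (i + N))"
    have Y: "a < Re (Y i)" "Y i \<noteq> z" for i using N X(1) by (auto simp: Y_def)
    have Ylim: "Y \<longlonglongrightarrow> z" unfolding Y_def using X(2) by (rule LIMSEQ_ignore_initial_segment)
    define q where "q = (\<lambda>i t. (theta_integrand (Y i) t - theta_integrand z t) / (Y i - z))"
    have "(\<lambda>i. LINT t|lborel. q i t) \<longlonglongrightarrow> (LINT t|lborel. - complex_of_real (ln t) * theta_integrand z t)"
    proof (rule integral_dominated_convergence[OF _ _ w])
      show "AE t in lborel. (\<lambda>i. q i t) \<longlonglongrightarrow> - complex_of_real (ln t) * theta_integrand z t"
      proof (rule AE_I2)
        fix t
        have "((\<lambda>y. (theta_integrand y t - theta_integrand z t) / (y - z)) \<longlongrightarrow> - complex_of_real (ln t) * theta_integrand z t) (at z)"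
          using der[where S = UNIV and y = z and t = t] by (simp add: has_field_derivative_iff)
        then show "(\<lambda>i. q i t) \<longlonglongrightarrow> - complex_of_real (ln t) * theta_integrand z t"
          using Y(2) Ylim unfolding tendsto_at_iff_sequentially q_def by (auto simp: o_def)
      qed
    next
      fix i
      show "AE t in lborel. norm (q i t) \<le> w t"
      proof (rule AE_I2)
        fix t
        have "norm (theta_integrand (Y i) t - theta_integrand z t) \<le> w t * norm (Y i - z)"
        proof (rule field_differentiable_bound[where S = "{y. a \<le> Re y}"])
          show "convex {y. a \<le> Re y}" by (rule convex_halfspace_Re_ge)
        qed (use der lnb Y(1)[of i] ab in auto)
        then show "norm (q i t) \<le> w t"
          using Y(2)[of i] by (simp add: q_def norm_divide field_simps)
      qed
    qed (auto simp: q_def)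
    moreover have "(LINT t|lborel. q i t) = (theta (Y i) - theta z) / (Y i - z)" for i
      using z ab Y(1)[of i] unfolding q_def theta
      by (simp add: integrable_theta_integrand)
    ultimately have "(\<lambda>i. (theta (X (i + N)) - theta z) / (X (i + N) - z)) \<longlonglongrightarrow> (LINT t|lborel. - complex_of_real (ln t) * theta_integrand z t)"
      by (simp add: Y_def)
    then show "((\<lambda>y. (theta y - theta z) / (y - z)) \<circ> X) \<longlonglongrightarrow> (LINT t|lborel. - complex_of_real (ln t) * theta_integrand z t)"
      unfolding o_def by (rule LIMSEQ_offset)
  qed
  then show ?thesis by (simp add: has_field_derivative_iff)
qed

lemma theta_holomorphic: "theta holomorphic_on {z. 1 < Re z}"
  unfolding holomorphic_on_def field_differentiable_def
  using theta_has_field_derivative has_field_derivative_at_within by blast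

end

theory Submission
  imports Defs
begin

text \<open>
  For \<open>Re z > 1\<close> the logarithm of the Euler product is the prime zeta function \<open>P z\<close>, the sum of \<open>p powr - z\<close> over
  the primes, plus a remainder \<open>H z\<close> whose series converges and is holomorphic already for \<open>Re z > 1/2\<close>
  (\<open>log_remainder_holomorphic\<close>). Partial summation turns the definition of \<open>theta\<close> into
  \<open>z * theta z = P z - L z\<close> (\<open>theta_of_real\<close>), where \<open>L\<close> comes from the density \<open>1 / ln t\<close> and satisfies
  \<open>L' z = - 2 powr (1 - z) / (z - 1)\<close>. Therefore zeta is the exponential of \<open>z * theta z + H z + L z\<close>. If
  \<open>theta\<close> continues to \<open>Re z > 1/2\<close>, then so does the logarithmic derivative of zeta, except for its pole at 1,
  and a zero of zeta would be a further pole of it: zeta has no zeros with real part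
  above \<open>1/2\<close> (\<open>zeta_no_zero_right\<close>).

  Zeros on the other side of the critical line are reflected to this one by the functional equation
  (\<open>zeta_functional_equation\<close>). It is obtained from the integral of \<open>t powr (s - 1) / (exp t - 1)\<close>, which is
  \<open>\<Gamma>(s) \<zeta>(s)\<close>: continued to \<open>-1 < s < 0\<close>, the integrand becomes \<open>t powr (s - 1)\<close> times a function whose partial
  fractions \<open>2 * t / ((2 * pi * n) ^ 2 + t ^ 2)\<close> can be integrated term by term
  (\<open>has_bochner_integral_zeta_left\<close>). The factors that accompany \<open>\<zeta>(s)\<close> and \<open>\<zeta>(1 - s)\<close> are a power and Gamma
  values, which are finite and nonzero in the critical strip.
\<close>

section \<open>Parametric integrals and accumulation points\<close>

text \<open>Locally dominated families may be differentiated under the integral sign. No bound on the derivatives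
  is assumed: Cauchy's inequality on a disc of a third of the radius derives one from the bound on the values.\<close>
lemma has_field_derivative_integral:
  fixes f :: "complex \<Rightarrow> 'a \<Rightarrow> complex"
  assumes r: "0 < r"
    and hol: "\<And>t. t \<in> space M \<Longrightarrow> (\<lambda>s. f s t) holomorphic_on ball z r"
    and meas: "\<And>s. s \<in> ball z r \<Longrightarrow> f s \<in> borel_measurable M"
    and bound: "\<And>s t. s \<in> ball z r \<Longrightarrow> t \<in> space M \<Longrightarrow> norm (f s t) \<le> w t"
    and w: "integrable M w"
  shows "((\<lambda>s. LINT t|M. f s t) has_field_derivative (LINT t|M. deriv (\<lambda>s. f s t) z)) (at z)"
proof -
  define d where "d = r / 3"
  have d: "0 < d" using r by (simp add: d_def)
  have sub: "cball y d \<subseteq> ball z r" if "y \<in> ball z d" for y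
  proof
    fix u assume "u \<in> cball y d"
    then have "dist z u \<le> dist z y + dist y u" "dist y u \<le> d" "dist z y < d"
      using that by (auto intro: dist_triangle)
    then show "u \<in> ball z r" using r by (simp add: d_def)
  qed
  have der: "((\<lambda>s. f s t) has_field_derivative deriv (\<lambda>s. f s t) y) (at y within S)"
    if "t \<in> space M" "y \<in> ball z d" for t y S
  proof -
    have "y \<in> ball z r" using sub[OF that(2)] d centre_in_cball[of y d] by (meson less_imp_le subsetD)
    then show ?thesis
      using holomorphic_derivI[OF hol[OF that(1)] open_ball] by blast
  qed
  have dbound: "norm (deriv (\<lambda>s. f s t) y) \<le> w t / d"
    if t: "t \<in> space M" and y: "y \<in> ball z d" for t y
  proof -
    have h: "(\<lambda>s. f s t) holomorphic_on cball y d"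
      using hol[OF t] sub[OF y] by (rule holomorphic_on_subset)
    have "norm ((deriv ^^ 1) (\<lambda>s. f s t) y) \<le> fact 1 * w t / d ^ 1"
    proof (rule Cauchy_inequality)
      show "(\<lambda>s. f s t) holomorphic_on ball y d" using h by (rule holomorphic_on_subset) auto
      show "continuous_on (cball y d) (\<lambda>s. f s t)" using h by (rule holomorphic_on_imp_continuous_on)
      show "norm (f x t) \<le> w t" if "norm (y - x) = d" for x
        using sub[OF y] that by (intro bound t) (auto simp: dist_norm)
    qed (rule d)
    then show ?thesis by simp
  qed
  have "((\<lambda>y. ((LINT t|M. f y t) - (LINT t|M. f z t)) / (y - z)) \<longlongrightarrow> (LINT t|M. deriv (\<lambda>s. f s t) z)) (at z)"
    unfolding tendsto_at_iff_sequentially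
  proof (intro allI impI)
    fix X :: "nat \<Rightarrow> complex" assume X: "\<forall>i. X i \<in> UNIV - {z}" "X \<longlonglongrightarrow> z"
    have "eventually (\<lambda>i. X i \<in> ball z d) sequentially"
      using X(2) d by (intro topological_tendstoD) auto
    then obtain N where N: "\<And>i. i \<ge> N \<Longrightarrow> X i \<in> ball z d"
      by (auto simp: eventually_sequentially)
    define Y where "Y = (\<lambda>i. X (i + N))"
    have Y: "Y i \<in> ball z d" "Y i \<noteq> z" for i using N X(1) by (auto simp: Y_def)
    have Yr: "Y i \<in> ball z r" for i using Y(1)[of i] r by (simp add: d_def)
    have zr: "z \<in> ball z r" using r by simp
    have Ylim: "Y \<longlonglongrightarrow> z" unfolding Y_def using X(2) by (rule LIMSEQ_ignore_initial_segment)
    have int: "integrable M (f s)" if "s \<in> ball z r" for s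
      by (rule Bochner_Integration.integrable_bound[OF w meas[OF that]])
        (use bound[OF that] in \<open>auto intro!: AE_I2 order_trans[OF _ abs_ge_self]\<close>)
    define q where "q = (\<lambda>i t. (f (Y i) t - f z t) / (Y i - z))"
    have q_meas: "q i \<in> borel_measurable M" for i
      unfolding q_def using meas[OF Yr[of i]] meas[OF zr] by measurable
    have lim: "(\<lambda>i. q i t) \<longlonglongrightarrow> deriv (\<lambda>s. f s t) z" if t: "t \<in> space M" for t
    proof -
      have "((\<lambda>y. (f y t - f z t) / (y - z)) \<longlongrightarrow> deriv (\<lambda>s. f s t) z) (at z)"
        using der[OF t, of z UNIV] d by (simp add: has_field_derivative_iff)
      then show ?thesis
        using Y(2) Ylim unfolding tendsto_at_iff_sequentially q_def by (auto simp: o_def)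
    qed
    have "(\<lambda>i. LINT t|M. q i t) \<longlonglongrightarrow> (LINT t|M. deriv (\<lambda>s. f s t) z)"
    proof (rule integral_dominated_convergence[where w = "\<lambda>t. w t / d"])
      show "(\<lambda>t. deriv (\<lambda>s. f s t) z) \<in> borel_measurable M"
        by (rule borel_measurable_LIMSEQ_metric[OF q_meas lim])
      show "integrable M (\<lambda>t. w t / d)" using w by simp
      show "AE t in M. (\<lambda>i. q i t) \<longlonglongrightarrow> deriv (\<lambda>s. f s t) z"
        by (rule AE_I2) (rule lim)
      show "AE t in M. norm (q i t) \<le> w t / d" for i
      proof (rule AE_I2)
        fix t assume t: "t \<in> space M"
        have "norm (f (Y i) t - f z t) \<le> w t / d * norm (Y i - z)"
          by (rule field_differentiable_bound[where S = "ball z d"])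
            (use der[OF t] dbound[OF t] Y(1)[of i] d in auto)
        then show "norm (q i t) \<le> w t / d"
          using Y(2)[of i] by (simp add: q_def norm_divide field_simps)
      qed
    qed (rule q_meas)
    moreover have "(LINT t|M. q i t) = ((LINT t|M. f (Y i) t) - (LINT t|M. f z t)) / (Y i - z)" for i
      unfolding q_def using int[OF Yr[of i]] int[OF zr] by simp
    ultimately have "(\<lambda>i. ((LINT t|M. f (X (i + N)) t) - (LINT t|M. f z t)) / (X (i + N) - z)) \<longlonglongrightarrow> (LINT t|M. deriv (\<lambda>s. f s t) z)"
      by (simp add: Y_def)
    then show "((\<lambda>y. ((LINT t|M. f y t) - (LINT t|M. f z t)) / (y - z)) \<circ> X) \<longlonglongrightarrow> (LINT t|M. deriv (\<lambda>s. f s t) z)"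
      unfolding o_def by (rule LIMSEQ_offset)
  qed
  then show ?thesis by (simp add: has_field_derivative_iff)
qed

text \<open>Every point of an open set of reals is an accumulation point of it in the complex plane, so identities
  between holomorphic functions need only be checked for real arguments. There every
  integral splits into parts with nonnegative integrand, to which Tonelli's theorem applies.\<close>
lemma of_real_islimpt_image:
  assumes "open S" "x \<in> S"
  shows "complex_of_real x islimpt of_real ` S"
proof (rule islimpt_isCont_image)
  show "x islimpt S"
    using assms by (simp add: islimpt_UNIV_iff open_imp_islimpt)
  show "\<forall>\<^sub>F y in at x. complex_of_real y \<noteq> of_real x"
    by (auto simp: eventually_at_filter)
qed (intro continuous_intros)

section \<open>The Euler product on the real axis\<close>

lemma summable_on_nat_powr:
  "1 < x \<Longrightarrow> (\<lambda>n::nat. real n powr - x) summable_on A"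
  by (rule summable_on_subset_banach[OF _ subset_UNIV], rule norm_summable_imp_summable_on)
    (simp add: summable_real_powr_iff)

text \<open>The sieve of Eratosthenes: removing the multiples of a further prime \<open>q\<close> from the surviving
  numbers multiplies the sum by \<open>1 - q powr - x\<close>, because those multiples are \<open>q\<close> times the survivors.
  The number 0 does not disturb the sums: \<open>0 powr - x\<close> is 0.\<close>
lemma infsum_sieve:
  fixes x :: real and F :: "nat set"
  assumes x: "1 < x" and "finite F" "\<And>p. p \<in> F \<Longrightarrow> prime p"
  shows "(\<Sum>\<^sub>\<infinity>n\<in>{n::nat. \<forall>p\<in>F. \<not> p dvd n}. real n powr - x)
    = (\<Sum>\<^sub>\<infinity>n::nat. real n powr - x) * (\<Prod>p\<in>F. 1 - real p powr - x)"
  using assms(2,3)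
proof (induction F rule: finite_induct)
  case (insert q F)
  define f where "f = (\<lambda>n::nat. real n powr - x)"
  define A where "A = {n::nat. \<forall>p\<in>F. \<not> p dvd n}"
  have IH: "infsum f A = infsum f UNIV * (\<Prod>p\<in>F. 1 - f p)"
    using insert by (simp add: f_def A_def)
  have q: "prime q" and F: "\<And>p. p \<in> F \<Longrightarrow> prime p" using insert by auto
  have sm: "f summable_on B" for B unfolding f_def by (rule summable_on_nat_powr[OF x])
  define B where "B = {n::nat. \<forall>p\<in>insert q F. \<not> p dvd n}"
  have img: "(\<lambda>m. q * m) ` A = {n \<in> A. q dvd n}"
  proof -
    have dv: "p dvd q * m \<longleftrightarrow> p dvd m" if "p \<in> F" for p m
    proof -
      have "\<not> p dvd q" using that F q insert.hyps(2) primes_dvd_imp_eq by blast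
      then show ?thesis using F[OF that] by (simp add: prime_dvd_mult_iff)
    qed
    have *: "q * m \<in> A \<longleftrightarrow> m \<in> A" for m
      using dv by (simp add: A_def)
    show ?thesis
    proof (intro set_eqI iffI)
      fix n assume "n \<in> {n \<in> A. q dvd n}"
      then obtain m where "n = q * m" "n \<in> A" by (blast elim: dvdE)
      with *[of m] show "n \<in> (\<lambda>m. q * m) ` A" by blast
    next
      fix n assume "n \<in> (\<lambda>m. q * m) ` A"
      then obtain m where "n = q * m" "m \<in> A" by blast
      then show "n \<in> {n \<in> A. q dvd n}" using *[of m] by simp
    qed
  qed
  have "A = B \<union> (\<lambda>m. q * m) ` A" unfolding img by (auto simp: A_def B_def)
  moreover have "B \<inter> (\<lambda>m. q * m) ` A = {}" by (auto simp: B_def)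
  ultimately have "infsum f A = infsum f B + infsum f ((\<lambda>m. q * m) ` A)"
    using infsum_Un_disjoint[OF sm sm, of B "(\<lambda>m. q * m) ` A"] by metis
  also have "infsum f ((\<lambda>m. q * m) ` A) = infsum (f \<circ> (\<lambda>m. q * m)) A"
    using q by (intro infsum_reindex) (auto simp: inj_on_def prime_gt_0_nat)
  also have "f \<circ> (\<lambda>m. q * m) = (\<lambda>m. f q * f m)"
    by (auto simp: f_def powr_mult)
  also have "infsum (\<lambda>m. f q * f m) A = f q * infsum f A"
    by (rule infsum_cmult_right) (use sm in auto)
  finally have "infsum f B = (1 - f q) * infsum f A" unfolding left_diff_distrib by linarith
  with IH insert.hyps show ?case by (simp add: f_def B_def mult_ac)
qed simp

text \<open>The logarithm of the Euler product. After sieving by all primes below \<open>N\<close> the number 1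
  survives, and every other survivor is at least \<open>N\<close>; hence the sieved sum lies between 1 and 1 plus a tail of the
  zeta series.\<close>
lemma ln_zeta_sums:
  fixes x :: real
  assumes x: "1 < x"
  shows "(\<lambda>n. if prime n then - ln (1 - real n powr - x) else 0) sums ln (\<Sum>n. real (Suc n) powr - x)"
proof -
  define f where "f = (\<lambda>n::nat. real n powr - x)"
  define Z where "Z = (\<Sum>n. f (Suc n))"
  define P where "P = (\<lambda>N. {p::nat. prime p \<and> p < N})"
  have sm: "f summable_on B" for B unfolding f_def by (rule summable_on_nat_powr[OF x])
  have fs: "summable f" using x by (simp add: f_def summable_real_powr_iff)
  have f0: "f 0 = 0" by (simp add: f_def)
  have inf_sum: "f sums infsum f UNIV" using sm by (intro has_sum_imp_sums) (simp add: has_sum_infsum)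
  then have Z: "infsum f UNIV = Z"
    using suminf_split_head[OF fs] f0 by (simp add: Z_def sums_iff)
  have fnn: "0 \<le> f n" for n by (simp add: f_def)
  have lim: "(\<lambda>N. Z * (\<Prod>p\<in>P N. 1 - f p)) \<longlonglongrightarrow> 1"
  proof (rule tendsto_sandwich)
    define A where "A = (\<lambda>N. {n::nat. \<forall>p\<in>P N. \<not> p dvd n})"
    have fin: "finite (P N)" for N by (rule finite_subset[of _ "{..<N}"]) (auto simp: P_def)
    have eq: "Z * (\<Prod>p\<in>P N. 1 - f p) = infsum f (A N)" for N
      using infsum_sieve[OF x fin, of N] Z by (auto simp: A_def P_def f_def)
    have one: "1 \<in> A N" for N by (auto simp: A_def P_def)
    have split: "infsum f (A N) = 1 + infsum f (A N - {1})" for N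
    proof -
      have "infsum f ({1} \<union> (A N - {1})) = infsum f {1} + infsum f (A N - {1})"
        by (intro infsum_Un_disjoint sm) auto
      moreover have "{1} \<union> (A N - {1}) = A N" using one by auto
      ultimately show ?thesis by (simp add: f_def)
    qed
    show "eventually (\<lambda>N. 1 \<le> Z * (\<Prod>p\<in>P N. 1 - f p)) sequentially"
      unfolding eq split by (rule always_eventually, rule allI, subst le_add_same_cancel1, rule infsum_nonneg, rule fnn)
    have up: "infsum f (A N) \<le> 1 + (Z - sum f {..<N})" for N
    proof -
      have sub: "n \<in> {N..} \<or> n = 0" if n: "n \<in> A N - {1}" for n
      proof (rule ccontr)
        assume *: "\<not> (n \<in> {N..} \<or> n = 0)"
        with n obtain p where p: "prime p" "p dvd n" using prime_factor_nat[of n] by auto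
        with * have "p < N" using dvd_imp_le[of p n] by auto
        with p n show False by (auto simp: A_def P_def)
      qed
      have "infsum f (A N - {1}) \<le> infsum f {N..}"
      proof (rule infsum_mono_neutral[OF sm sm])
        fix n assume "n \<in> A N - {1} - {N..}"
        then have "n = 0" using sub[of n] by blast
        then show "f n \<le> 0" by (simp add: f0)
      qed (use fnn in auto)
      also have "infsum f UNIV = infsum f {..<N} + infsum f {N..}"
        by (subst infsum_Un_disjoint[symmetric, OF sm sm]) (auto intro!: arg_cong[of _ _ "infsum f"])
      then have "infsum f {N..} = Z - sum f {..<N}" by (simp add: Z)
      finally show ?thesis by (simp add: split)
    qed
    then show "eventually (\<lambda>N. Z * (\<Prod>p\<in>P N. 1 - f p) \<le> 1 + (Z - sum f {..<N})) sequentially"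
      by (simp add: eq)
    have "(\<lambda>N. 1 + (Z - sum f {..<N})) \<longlonglongrightarrow> 1 + (Z - Z)"
      using inf_sum unfolding sums_def Z by (intro tendsto_intros)
    then show "(\<lambda>N. 1 + (Z - sum f {..<N})) \<longlonglongrightarrow> 1" by simp
  qed simp
  have Zpos: "0 < Z"
  proof -
    have "f 1 \<le> infsum f UNIV"
      using infsum_mono_neutral[OF sm sm, of "{1}" UNIV] fnn by simp
    then have "f 1 \<le> Z" unfolding Z by simp
    moreover have "f 1 = 1" by (simp add: f_def)
    ultimately show ?thesis by simp
  qed
  have fpos: "0 < 1 - f p" if "prime p" for p
  proof -
    have "real p powr - x < 1"
      using prime_gt_1_nat[OF that] x by (simp add: powr_less_one)
    then show ?thesis by (simp add: f_def)
  qed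
  have "(\<lambda>N. ln (Z * (\<Prod>p\<in>P N. 1 - f p))) \<longlonglongrightarrow> ln 1"
    by (intro tendsto_ln lim) simp
  moreover have "ln (Z * (\<Prod>p\<in>P N. 1 - f p)) = ln Z - (\<Sum>n<N. if prime n then - ln (1 - f n) else 0)" for N
  proof -
    have pos: "\<And>p. p \<in> P N \<Longrightarrow> 0 < 1 - f p" using fpos by (auto simp: P_def)
    have "ln (Z * (\<Prod>p\<in>P N. 1 - f p)) = ln Z + ln (\<Prod>p\<in>P N. 1 - f p)"
      using Zpos pos by (intro ln_mult_pos prod_pos)
    also have "ln (\<Prod>p\<in>P N. 1 - f p) = (\<Sum>p\<in>P N. ln (1 - f p))"
      using pos by (intro ln_prod) (auto simp: P_def dest: less_imp_neq)
    also have "\<dots> = (\<Sum>p\<in>{n \<in> {..<N}. prime n}. ln (1 - f p))"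
      by (rule sum.cong) (auto simp: P_def)
    also have "(\<Sum>p\<in>{n \<in> {..<N}. prime n}. ln (1 - f p)) = (\<Sum>n<N. if prime n then ln (1 - f n) else 0)"
      by (rule sum.inter_filter) simp
    also have "\<dots> = - (\<Sum>n<N. if prime n then - ln (1 - f n) else 0)"
      unfolding sum_negf[symmetric] by (rule sum.cong) auto
    finally show ?thesis by simp
  qed
  ultimately have "(\<lambda>N. ln Z - (\<Sum>n<N. if prime n then - ln (1 - f n) else 0)) \<longlonglongrightarrow> 0" by simp
  from tendsto_diff[OF tendsto_const[of "ln Z"] this]
  have "(\<lambda>N. \<Sum>n<N. if prime n then - ln (1 - f n) else 0) \<longlonglongrightarrow> ln Z" by simp
  then show ?thesis unfolding sums_def Z_def f_def .
qed

lemma riemann_zeta_of_real: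
  assumes "1 < x"
  shows "riemann_zeta (of_real x) = of_real (\<Sum>n. real (Suc n) powr - x)"
proof -
  have "complex_of_real (\<Sum>n. real (Suc n) powr - x) = (\<Sum>n. of_real (real (Suc n) powr - x))"
    using assms by (intro suminf_of_real summable_Suc_powr) simp
  also have "\<dots> = (\<Sum>n. of_nat (Suc n) powr - complex_of_real x)"
    by (simp add: powr_of_real[symmetric] del: of_nat_Suc)
  finally show ?thesis using riemann_zeta_eq_series[of "of_real x"] assms by simp
qed

section \<open>The function theta on the real axis\<close>

lemma nn_integral_powr_atLeast:
  fixes x c :: real
  assumes "0 < x" "0 < c"
  shows "(\<integral>\<^sup>+t. ennreal (indicator {c..} t * t powr (- x - 1)) \<partial>lborel) = ennreal (c powr - x / x)"
  using nn_integral_has_integral_lebesgue[OF _ has_integral_powr_to_inf[of "- x - 1" c]] assms by simp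

text \<open>Partial summation, read as an exchange of sum and integral: \<open>prime_pi\<close> counts one for each prime
  \<open>n \<le> t\<close>, and the integral over \<open>t \<ge> n\<close> is elementary.\<close>
lemma nn_integral_prime_pi:
  assumes x: "1 < x"
  shows "(\<integral>\<^sup>+t. ennreal (indicator {2..} t * (prime_pi t * t powr (- x - 1))) \<partial>lborel)
    = (\<Sum>n. ennreal (if prime n then real n powr - x / x else 0))"
proof -
  define f where "f = (\<lambda>(n::nat) t. if prime n then indicator {real n..} t * t powr (- x - 1) else (0::real))"
  have pt: "ennreal (indicator {2..} t * (prime_pi t * t powr (- x - 1))) = (\<Sum>n. ennreal (f n t))" for t
  proof -
    define S where "S = {p::nat. prime p \<and> real p \<le> t}"
    have "(\<Sum>n. ennreal (f n t)) = (\<Sum>n\<in>S. ennreal (f n t))"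
      by (rule suminf_finite) (auto simp: S_def f_def finite_primes_le)
    also have "\<dots> = (\<Sum>n\<in>S. ennreal (t powr (- x - 1)))"
      by (rule sum.cong) (auto simp: S_def f_def)
    also have "\<dots> = ennreal (prime_pi t * t powr (- x - 1))"
      by (simp only: prime_pi_def S_def[symmetric] sum_constant ennreal_of_nat_eq_real_of_nat)
        (rule ennreal_mult[symmetric], auto)
    also have "\<dots> = ennreal (indicator {2..} t * (prime_pi t * t powr (- x - 1)))"
    proof (cases "2 \<le> t")
      case False
      have "p \<notin> S" for p
      proof
        assume "p \<in> S"
        then have "2 \<le> p" "real p \<le> t" by (auto simp: S_def dest: prime_ge_2_nat)
        with False show False by linarith
      qed
      then have "S = {}" by blast
      then show ?thesis using False unfolding prime_pi_def S_def[symmetric] by simp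
    qed simp
    finally show ?thesis by (rule sym)
  qed
  have "(\<integral>\<^sup>+t. ennreal (f n t) \<partial>lborel) = ennreal (if prime n then real n powr - x / x else 0)" for n
    using nn_integral_powr_atLeast[of x "real n"] x prime_gt_0_nat[of n]
    by (cases "prime n") (simp_all add: f_def)
  moreover have "(\<integral>\<^sup>+t. (\<Sum>n. ennreal (f n t)) \<partial>lborel) = (\<Sum>n. \<integral>\<^sup>+t. ennreal (f n t) \<partial>lborel)"
    by (rule nn_integral_suminf) (simp add: f_def)
  ultimately show ?thesis unfolding pt by simp
qed

text \<open>The continuous analogue of the previous computation, with the density \<open>1 / ln s\<close> in place of the
  primes and Tonelli's theorem for the exchange.\<close>
lemma nn_integral_Li:
  assumes x: "1 < x"
  shows "(\<integral>\<^sup>+t. ennreal (indicator {2..} t * (Li t * t powr (- x - 1))) \<partial>lborel)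
    = (\<integral>\<^sup>+s. ennreal (indicator {2..} s * (s powr - x / ln s) / x) \<partial>lborel)"
proof -
  have Li: "ennreal (Li t) = (\<integral>\<^sup>+s. ennreal (indicator {2..t} s * (1 / ln s)) \<partial>lborel)" for t
    using nn_integral_eq_integral[OF set_integrable_inverse_ln[of t, unfolded set_integrable_def]]
    by (simp add: Li_def set_lebesgue_integral_def indicator_def)
  have "(\<integral>\<^sup>+t. ennreal (indicator {2..} t * (Li t * t powr (- x - 1))) \<partial>lborel)
      = (\<integral>\<^sup>+t. \<integral>\<^sup>+s. ennreal (indicator {2..} s * (1 / ln s)) * ennreal (indicator {s..} t * t powr (- x - 1)) \<partial>lborel \<partial>lborel)"
  proof (rule nn_integral_cong)
    fix t :: real
    have "ennreal (indicator {2..} t * (Li t * t powr (- x - 1)))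
        = ennreal (Li t) * ennreal (indicator {2..} t * t powr (- x - 1))"
      using Li_bounds[of t] by (auto simp: indicator_def ennreal_mult')
    also have "\<dots> = (\<integral>\<^sup>+s. ennreal (indicator {2..t} s * (1 / ln s)) * ennreal (indicator {2..} t * t powr (- x - 1)) \<partial>lborel)"
      unfolding Li by (rule nn_integral_multc[symmetric]) simp
    also have "\<dots> = (\<integral>\<^sup>+s. ennreal (indicator {2..} s * (1 / ln s)) * ennreal (indicator {s..} t * t powr (- x - 1)) \<partial>lborel)"
      by (rule nn_integral_cong) (auto simp: indicator_def)
    finally show "ennreal (indicator {2..} t * (Li t * t powr (- x - 1))) = \<dots>" .
  qed
  also have "\<dots> = (\<integral>\<^sup>+s. \<integral>\<^sup>+t. ennreal (indicator {2..} s * (1 / ln s)) * ennreal (indicator {s..} t * t powr (- x - 1)) \<partial>lborel \<partial>lborel)"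
    by (rule lborel_pair.Fubini') (auto simp: case_prod_unfold indicator_def)
  also have "\<dots> = (\<integral>\<^sup>+s. ennreal (indicator {2..} s * (s powr - x / ln s) / x) \<partial>lborel)"
  proof (rule nn_integral_cong)
    fix s :: real
    show "(\<integral>\<^sup>+t. ennreal (indicator {2..} s * (1 / ln s)) * ennreal (indicator {s..} t * t powr (- x - 1)) \<partial>lborel)
        = ennreal (indicator {2..} s * (s powr - x / ln s) / x)"
      using x nn_integral_powr_atLeast[of x s]
      by (subst nn_integral_cmult) (auto simp: indicator_def ennreal_mult'[symmetric] field_simps)
  qed
  finally show ?thesis .
qed

lemma integrable_bounded_by_powr:
  fixes f :: "real \<Rightarrow> real"
  assumes x: "1 < x" and f: "f \<in> borel_measurable borel"
    and b: "\<And>t. 2 \<le> t \<Longrightarrow> \<bar>f t\<bar> \<le> C * t powr - x"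
  shows "integrable lborel (\<lambda>t. indicator {2..} t * f t)"
proof (rule Bochner_Integration.integrable_bound)
  show "integrable lborel (\<lambda>t. C * (indicator {2..} t * t powr - x))"
    by (intro integrable_mult_right integrable_theta_majorant x)
  show "AE t in lborel. norm (indicator {2..} t * f t) \<le> norm (C * (indicator {2..} t * t powr - x))"
    using b by (intro AE_I2) (auto simp: indicator_def intro: order_trans[OF _ abs_ge_self])
qed (use f in simp)

text \<open>The number \<open>x * theta x\<close> compares the prime zeta function, the leading part of \<open>ln \<zeta>(x)\<close>,
  with the same expression for the density \<open>1 / ln t\<close>.\<close>
lemma theta_of_real:
  assumes x: "1 < x"
  shows "of_real x * theta (of_real x)
    = complex_of_real ((\<Sum>n. if prime n then real n powr - x else 0)
        - (LINT t|lborel. indicator {2..} t * (t powr - x / ln t)))"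
proof -
  define p where "p = (\<lambda>t. indicator {2..} t * (prime_pi t * t powr (- x - 1)))"
  define l where "l = (\<lambda>t. indicator {2..} t * (Li t * t powr (- x - 1)))"
  define k where "k = (\<lambda>t::real. indicator {2..} t * (t powr - x / ln t))"
  have pw: "t * t powr (- x - 1) = t powr - x" if "2 \<le> t" for t :: real
    using that powr_add[of t 1 "- x - 1"] by simp
  have ip: "integrable lborel p" unfolding p_def
  proof (rule integrable_bounded_by_powr[OF x])
    fix t :: real assume "2 \<le> t"
    then show "\<bar>prime_pi t * t powr (- x - 1)\<bar> \<le> 1 * t powr - x"
      using prime_pi_bounds[of t] unfolding pw[OF \<open>2 \<le> t\<close>, symmetric] by (simp add: abs_mult mult_right_mono)
  qed simp
  have il: "integrable lborel l" unfolding l_def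
  proof (rule integrable_bounded_by_powr[OF x])
    fix t :: real assume t: "2 \<le> t"
    have "Li t * t powr (- x - 1) \<le> t / ln 2 * t powr (- x - 1)"
      using Li_bounds[of t] t by (intro mult_right_mono) auto
    also have "\<dots> = 1 / ln 2 * t powr - x" unfolding pw[OF t, symmetric] by simp
    finally show "\<bar>Li t * t powr (- x - 1)\<bar> \<le> 1 / ln 2 * t powr - x"
      using Li_bounds[of t] t by (simp add: abs_mult)
  qed simp
  have "integral\<^sup>L lborel p = enn2real (\<Sum>n. ennreal (if prime n then real n powr - x / x else 0))"
    using nn_integral_prime_pi[OF x] prime_pi_bounds ip
    by (subst integral_eq_nn_integral) (auto simp: p_def indicator_def)
  also have "\<dots> = (\<Sum>n. if prime n then real n powr - x / x else 0)"
  proof -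
    have "summable (\<lambda>n. real n powr - x / x)"
      using x by (intro summable_divide) (simp add: summable_real_powr_iff)
    then have "summable (\<lambda>n. if prime n then real n powr - x / x else 0)"
      by (rule summable_comparison_test') (use x in auto)
    then show ?thesis
      using x by (subst suminf_ennreal2) (auto intro!: suminf_nonneg enn2real_ennreal)
  qed
  also have "\<dots> = (\<Sum>n. (if prime n then real n powr - x else 0) / x)"
    by (rule arg_cong[of _ _ suminf]) auto
  also have "\<dots> = (\<Sum>n. if prime n then real n powr - x else 0) / x"
  proof (rule suminf_divide)
    show "summable (\<lambda>n. if prime n then real n powr - x else 0)"
      by (rule summable_comparison_test'[of "\<lambda>n. real n powr - x"]) (use x in \<open>auto simp: summable_real_powr_iff\<close>)
  qed
  finally have P: "x * integral\<^sup>L lborel p = (\<Sum>n. if prime n then real n powr - x else 0)"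
    using x by simp
  have "integral\<^sup>L lborel l = enn2real (\<integral>\<^sup>+s. ennreal (k s / x) \<partial>lborel)"
    using nn_integral_Li[OF x] Li_bounds il
    by (subst integral_eq_nn_integral) (auto simp: l_def k_def indicator_def)
  also have "\<dots> = integral\<^sup>L lborel (\<lambda>s. k s / x)"
    using x by (intro enn2real_nn_integral_eq_integral) (auto simp: k_def indicator_def)
  finally have L: "x * integral\<^sup>L lborel l = integral\<^sup>L lborel k" using x by simp
  have "theta_integrand (of_real x) t = complex_of_real (p t - l t)" for t
  proof (cases "2 \<le> t")
    case True
    have "complex_of_real t powr (of_real x + 1) = of_real (t powr (x + 1))"
      using True by (simp flip: powr_of_real)
    then show ?thesis
      using True by (simp add: theta_integrand_def p_def l_def powr_minus_divide[of t "x + 1", simplified] diff_divide_distrib)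
  qed (simp add: theta_integrand_def p_def l_def)
  then have "theta (of_real x) = complex_of_real (integral\<^sup>L lborel p - integral\<^sup>L lborel l)"
    using Bochner_Integration.integral_diff[OF ip il]
    unfolding theta_def set_lebesgue_integral_def theta_integrand_def[symmetric]
    by (simp only: integral_complex_of_real)
  then show ?thesis
    unfolding P[symmetric] L[symmetric, unfolded k_def] by (simp only: of_real_mult[symmetric] right_diff_distrib)
qed

text \<open>This is the exponential integral: \<open>Li_kernel z\<close> is \<open>E\<^sub>1 ((z - 1) * ln 2)\<close>. Up to the factor \<open>z\<close> it is what
  \<open>Li\<close> contributes to \<open>theta\<close>.\<close>
definition Li_kernel :: "complex \<Rightarrow> complex" where
  "Li_kernel z = (LINT t|lborel. indicator {2..} t *\<^sub>R (of_real t powr - z / of_real (ln t)))"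

lemma Li_kernel_of_real:
  "Li_kernel (of_real x) = of_real (LINT t|lborel. indicator {2..} t * (t powr - x / ln t))"
proof -
  have "indicator {2..} t *\<^sub>R (complex_of_real t powr - of_real x / of_real (ln t))
      = of_real (indicator {2..} t * (t powr - x / ln t))" for t :: real
    by (cases "2 \<le> t") (simp_all add: powr_of_real[of t "- x", simplified, symmetric])
  then show ?thesis unfolding Li_kernel_def by (simp only: integral_complex_of_real)
qed

text \<open>Differentiation cancels the factor \<open>1 / ln t\<close> and leaves an elementary integral. The
  pole of the derivative at 1 reflects that of zeta.\<close>
lemma Li_kernel_derivative:
  assumes x: "1 < x"
  shows "(Li_kernel has_field_derivative - (2 powr (1 - of_real x) / (of_real x - 1))) (at (of_real x))"
proof -
  define r where "r = (x - 1) / 2"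
  define f where "f = (\<lambda>z t. indicator {2..} t *\<^sub>R (of_real t powr - z / complex_of_real (ln t)))"
  define w where "w = (\<lambda>t::real. indicator {2..} t * (1 / ln 2 * t powr - (x - r)))"
  have "((\<lambda>z. LINT t|lborel. f z t) has_field_derivative (LINT t|lborel. deriv (\<lambda>z. f z t) (of_real x))) (at (of_real x))"
  proof (rule has_field_derivative_integral)
    show "0 < r" using x by (simp add: r_def)
    show "(\<lambda>z. f z t) holomorphic_on ball (of_real x) r" for t
      unfolding f_def by (cases "2 \<le> t") (auto intro!: holomorphic_intros)
    show "f z \<in> borel_measurable lborel" for z
      unfolding f_def powr_def by measurable
    show "integrable lborel w"
      unfolding w_def by (rule integrable_bounded_by_powr[of "x - r" _ "1 / ln 2"]) (use x in \<open>auto simp: r_def field_simps\<close>)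
    fix z t assume "z \<in> ball (complex_of_real x) r"
    then have "\<bar>Re (of_real x - z)\<bar> < r"
      using abs_Re_le_cmod[of "of_real x - z"] by (simp add: dist_norm)
    then have z: "x - r \<le> Re z" by simp
    show "norm (f z t) \<le> w t"
    proof (cases "2 \<le> t")
      case True
      have "norm (f z t) = t powr - Re z / ln t"
        using True by (simp add: f_def norm_divide norm_powr_real_powr)
      also have "\<dots> \<le> t powr - (x - r) / ln 2"
        using True z by (intro frac_le powr_mono) auto
      finally show ?thesis using True by (simp add: w_def)
    qed (simp add: f_def w_def)
  qed
  moreover have d: "deriv (\<lambda>z. f z t) (of_real x) = complex_of_real (- (indicator {2..} t * t powr - x))" for t
  proof (cases "2 \<le> t")
    case True
    have "((\<lambda>z. f z t) has_field_derivative - (complex_of_real (ln t) * of_real t powr - of_real x / of_real (ln t))) (at (of_real x))"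
    proof -
      have "((\<lambda>z. complex_of_real t powr - z / of_real (ln t)) has_field_derivative
          Ln (of_real t) * of_real t powr - of_real x * (- 1) / of_real (ln t)) (at (of_real x))"
        by (intro DERIV_cdivide DERIV_chain2[OF has_field_derivative_powr_right] derivative_intros) (use True in auto)
      then show ?thesis using True by (simp add: f_def Ln_of_real)
    qed
    then show ?thesis
      using True powr_of_real[of t "- x"] by (simp add: DERIV_imp_deriv)
  qed (simp add: f_def)
  moreover have "(LINT t|lborel. deriv (\<lambda>z. f z t) (of_real x)) = of_real (- (2 powr (1 - x) / (x - 1)))"
  proof -
    have "(LINT t|lborel. indicator {2..} t * t powr - x) = 2 powr (1 - x) / (x - 1)"
    proof -
      have "((\<lambda>t. t powr - x) has_integral 2 powr (1 - x) / (x - 1)) {2..}"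
        using has_integral_powr_to_inf[of "- x" 2] x by (simp add: minus_divide_right)
      from nn_integral_has_integral_lebesgue[OF _ this]
      have "(\<integral>\<^sup>+t. ennreal (indicator {2..} t * t powr - x) \<partial>lborel) = ennreal (2 powr (1 - x) / (x - 1))"
        by simp
      then show ?thesis using x by (subst integral_eq_nn_integral) auto
    qed
    then show ?thesis unfolding d by (simp only: integral_complex_of_real Bochner_Integration.integral_minus)
  qed
  moreover have "complex_of_real 2 powr of_real (1 - x) = of_real (2 powr (1 - x))"
    by (rule powr_of_real) simp
  ultimately show ?thesis
    unfolding Li_kernel_def[abs_def] f_def by simp
qed

section \<open>Zeros to the right of the critical line\<close>

text \<open>With the values of \<open>theta\<close> and \<open>Li_kernel\<close> this accounts for the whole of \<open>ln \<zeta>\<close>: the linear parts of the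
  Euler factors form the prime zeta function.\<close>
definition log_remainder :: "complex \<Rightarrow> complex" where
  "log_remainder z = (\<Sum>n. if prime n then - Ln (1 - of_nat n powr - z) - of_nat n powr - z else 0)"

text \<open>The linear terms of the logarithms are removed, so the summands are of the size of \<open>n powr - 2 z\<close>
  and the series of their suprema over compact sets converges as soon as \<open>Re z > 1/2\<close>.\<close>
lemma log_remainder_holomorphic: "log_remainder holomorphic_on {z. Re z > 1/2}"
proof -
  define h where "h = (\<lambda>n z. if prime n then - Ln (1 - of_nat n powr - z) - of_nat n powr - z else 0 :: complex)"
  have nrm: "norm (of_nat n powr - z :: complex) = real n powr - Re z" if "prime n" for n z
    using prime_gt_0_nat[OF that] by (subst norm_powr_real_powr) auto
  have lt1: "real n powr - a < 1" if "prime n" "0 < a" for n a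
    using prime_gt_1_nat[OF that(1)] that(2) by (simp add: powr_less_one)
  have "(\<lambda>z. \<Sum>n. h n z) holomorphic_on zeta_halfplane (1/2)"
  proof (rule holomorphic_suminf_halfplane)
    show "h n holomorphic_on zeta_halfplane (1 / 2)" for n
    proof (cases "prime n")
      case True
      have "1 - of_nat n powr - z \<notin> \<real>\<^sub>\<le>\<^sub>0" if "z \<in> zeta_halfplane (1/2)" for z
      proof -
        have "norm (of_nat n powr - z :: complex) < 1"
          using lt1[OF True, of "Re z"] that nrm[OF True] by (simp add: zeta_halfplane_def)
        then have "Re (of_nat n powr - z :: complex) < 1" using complex_Re_le_cmod le_less_trans by blast
        then show ?thesis by (auto simp: complex_nonpos_Reals_iff)
      qed
      then show ?thesis
        using True prime_gt_0_nat[OF True] unfolding h_def by (auto intro!: holomorphic_intros)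
    qed (simp add: h_def)
    fix a b :: real assume a: "1 / 2 < a"
    define K where "K = 1 / (1 - 2 powr - a)"
    show "\<exists>M. summable M \<and> (\<forall>n z. a \<le> Re z \<and> norm z \<le> b \<longrightarrow> norm (h n z) \<le> M n)"
    proof (intro exI conjI allI impI)
      show "summable (\<lambda>n. K * real n powr (- (2 * a)))"
        using a by (intro summable_mult) (simp add: summable_real_powr_iff)
      fix n and z :: complex assume z: "a \<le> Re z \<and> norm z \<le> b"
      have K: "0 < K" using a lt1[of 2 a] by (simp add: K_def)
      show "norm (h n z) \<le> K * real n powr (- (2 * a))"
      proof (cases "prime n")
        case True
        define v where "v = (of_nat n powr - z :: complex)"
        have n2: "2 \<le> real n" using prime_ge_2_nat[OF True] by simp
        have v: "norm v \<le> real n powr - a" "norm v \<le> 2 powr - a"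
        proof -
          show 1: "norm v \<le> real n powr - a"
            using n2 z unfolding v_def nrm[OF True] by (intro powr_mono) auto
          have "real n powr - a \<le> 2 powr - a" using n2 a by (intro powr_mono2') auto
          with 1 show "norm v \<le> 2 powr - a" by linarith
        qed
        have "2 powr - a < 1" using a lt1[of 2 a] by simp
        with v have v1: "norm v < 1" by linarith
        have "h n z = - (Ln (1 + (- v)) - (- v))"
          using True by (simp add: h_def v_def)
        then have "norm (h n z) = norm (Ln (1 + (- v)) - (- v))"
          by (simp only: norm_minus_cancel)
        also have "\<dots> \<le> norm v ^ 2 / (1 - norm v)"
          using Ln_approx_linear[of "- v"] v1 by simp
        also have "\<dots> \<le> (real n powr - a) ^ 2 / (1 - 2 powr - a)"
          using v \<open>2 powr - a < 1\<close> by (intro frac_le power_mono) auto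
        also have "(real n powr - a) ^ 2 = real n powr (- (2 * a))"
          by (simp add: power2_eq_square flip: powr_add)
        finally show ?thesis by (simp add: K_def)
      qed (use K in \<open>simp add: h_def\<close>)
    qed
  qed
  then show ?thesis by (simp add: h_def log_remainder_def[abs_def] zeta_halfplane_def)
qed

lemma zeta_eq_exp_theta:
  assumes x: "1 < x"
  shows "riemann_zeta (of_real x)
    = exp (of_real x * theta (of_real x) + log_remainder (of_real x) + Li_kernel (of_real x))"
proof -
  define Z where "Z = (\<Sum>n. real (Suc n) powr - x)"
  define P where "P = (\<Sum>n. if prime n then real n powr - x else 0)"
  have s1: "(\<lambda>n. if prime n then - ln (1 - real n powr - x) else 0) sums ln Z"
    using ln_zeta_sums[OF x] by (simp add: Z_def)
  have "summable (\<lambda>n. if prime n then real n powr - x else 0)"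
    by (rule summable_comparison_test'[of "\<lambda>n. real n powr - x"]) (use x in \<open>auto simp: summable_real_powr_iff\<close>)
  then have s2: "(\<lambda>n. if prime n then real n powr - x else 0) sums P"
    unfolding P_def by (rule summable_sums)
  have "(\<lambda>n. complex_of_real ((if prime n then - ln (1 - real n powr - x) else 0) - (if prime n then real n powr - x else 0))) sums of_real (ln Z - P)"
    using sums_diff[OF s1 s2] by (rule sums_of_real)
  also have "(\<lambda>n. complex_of_real ((if prime n then - ln (1 - real n powr - x) else 0) - (if prime n then real n powr - x else 0)))
      = (\<lambda>n. if prime n then - Ln (1 - of_nat n powr - of_real x) - of_nat n powr - of_real x else 0)"
  proof
    fix n
    have pos: "1 - real n powr - x > 0" if "prime n"
      using prime_gt_1_nat[OF that] x by (simp add: powr_less_one)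
    have c: "of_nat n powr - complex_of_real x = of_real (real n powr - x)"
      using powr_of_real[of "real n" "- x"] by simp
    have "Ln (1 - of_nat n powr - complex_of_real x) = of_real (ln (1 - real n powr - x))" if "prime n"
      using Ln_of_real[OF pos[OF that]] unfolding c by simp
    then show "complex_of_real ((if prime n then - ln (1 - real n powr - x) else 0) - (if prime n then real n powr - x else 0))
      = (if prime n then - Ln (1 - of_nat n powr - of_real x) - of_nat n powr - of_real x else 0)"
      by (simp add: c)
  qed
  finally have "log_remainder (of_real x) = of_real (ln Z - P)"
    by (simp add: log_remainder_def sums_iff)
  moreover have "0 < Z"
    unfolding Z_def using x by (intro suminf_pos summable_Suc_powr) auto
  ultimately show ?thesis
    using theta_of_real[OF x, folded P_def] riemann_zeta_of_real[OF x, folded Z_def]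
    by (simp add: Li_kernel_of_real exp_of_real)
qed

text \<open>The quotient \<open>Q\<close> of zeta by the exponential of \<open>z * \<Theta> z + log_remainder z\<close> equals \<open>exp (Li_kernel z)\<close> for
  real \<open>z > 1\<close>, and hence solves the linear equation \<open>(z - 1) * Q' z + 2 powr (1 - z) * Q z = 0\<close>
  there. Both sides are holomorphic right of the critical line and off the pole, so the equation persists, and a solution of a
  first-order linear equation that vanishes at one point vanishes identically. Working with this equation
  avoids choosing a logarithm of \<open>z - 1\<close> on a domain that winds around the pole.\<close>
lemma zeta_no_zero_right:
  assumes hol: "\<Theta> holomorphic_on {z. Re z > 1/2}" and eq: "\<And>z. Re z > 1 \<Longrightarrow> \<Theta> z = theta z"
    and z0: "1/2 < Re z0" "z0 \<noteq> 1"
  shows "riemann_zeta z0 \<noteq> 0"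
proof
  assume zero: "riemann_zeta z0 = 0"
  define D where "D = {z. Re z > 1/2} - {1::complex}"
  have op: "open {z::complex. Re z > 1/2}" by (rule open_halfspace_Re_gt)
  have D: "open D" unfolding D_def using op by (intro open_Diff) auto
  have conn: "connected D" unfolding D_def
    by (intro connected_open_delete op convex_connected convex_halfspace_Re_gt) simp
  define Q where "Q = (\<lambda>z. riemann_zeta z * exp (- (z * \<Theta> z + log_remainder z)))"
  have Q: "Q holomorphic_on D" unfolding Q_def
    by (intro holomorphic_intros holomorphic_on_subset[OF hol] holomorphic_on_subset[OF log_remainder_holomorphic]
        holomorphic_on_subset[OF riemann_zeta_holomorphic]) (auto simp: D_def)
  have Q_real: "Q (of_real x) = exp (Li_kernel (of_real x))" if "1 < x" for x
    unfolding Q_def zeta_eq_exp_theta[OF that] using eq[of "of_real x"] that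
    by (simp flip: exp_add)
  define E where "E = (\<lambda>z. (z - 1) * deriv Q z + 2 powr (1 - z) * Q z)"
  have E: "E holomorphic_on D" unfolding E_def
    by (intro holomorphic_intros holomorphic_deriv Q D) auto
  have E_real: "E (of_real x) = 0" if x: "1 < x" for x
  proof -
    let ?r = "complex_of_real x"
    have "((\<lambda>z. exp (Li_kernel z) - Q z) has_field_derivative
        exp (Li_kernel ?r) * - (2 powr (1 - ?r) / (?r - 1)) - deriv Q ?r) (at ?r)"
      by (intro derivative_intros DERIV_chain2[OF DERIV_exp] Li_kernel_derivative[OF x] holomorphic_derivI[OF Q D])
        (use x in \<open>auto simp: D_def\<close>)
    then have "((\<lambda>z. exp (Li_kernel z) - Q z) has_field_derivative
        exp (Li_kernel ?r) * - (2 powr (1 - ?r) / (?r - 1)) - deriv Q ?r) (at ?r within of_real ` {1<..})"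
      by (rule has_field_derivative_at_within)
    moreover have "((\<lambda>z. exp (Li_kernel z) - Q z) has_field_derivative 0) (at ?r within of_real ` {1<..})"
      by (rule has_field_derivative_transform_within[where f = "\<lambda>_. 0" and d = 1]) (use x Q_real in auto)
    moreover have "at ?r within of_real ` {1<..} \<noteq> bot"
      using of_real_islimpt_image[of "{1<..}" x] x by (simp add: trivial_limit_within)
    ultimately have "exp (Li_kernel ?r) * - (2 powr (1 - ?r) / (?r - 1)) - deriv Q ?r = 0"
      using has_field_derivative_unique by blast
    then have "deriv Q ?r = - (Q ?r * (2 powr (1 - ?r) / (?r - 1)))"
      by (simp add: Q_real[OF x])
    moreover have "?r - 1 \<noteq> 0" using x by simp
    ultimately show ?thesis by (simp add: E_def)
  qed
  have E0: "E z = 0" if "z \<in> D" for z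
  proof (rule analytic_continuation[OF E D conn])
    show "of_real ` {1<..} \<subseteq> D" by (auto simp: D_def)
    show "2 \<in> D" by (simp add: D_def)
    show "2 islimpt complex_of_real ` {1<..}"
      using of_real_islimpt_image[of "{1<..}" 2] by simp
  qed (use E_real that in auto)
  have Qz0: "Q z0 = 0" by (simp add: Q_def zero)
  have z0D: "z0 \<in> D" using z0 by (simp add: D_def)
  obtain e where e: "0 < e" "ball z0 e \<subseteq> D" using D z0D open_contains_ball by blast
  have hol_h: "(\<lambda>z. 2 powr (1 - z) / (z - 1)) holomorphic_on ball z0 e"
    using e(2) by (intro holomorphic_intros) (auto simp: D_def)
  obtain g where g: "\<And>z. z \<in> ball z0 e \<Longrightarrow> (g has_field_derivative 2 powr (1 - z) / (z - 1)) (at z within ball z0 e)"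
    using holomorphic_convex_primitive'[OF convex_ball open_ball hol_h] by blast
  have "((\<lambda>z. Q z * exp (g z)) has_field_derivative 0) (at z within ball z0 e)" if z: "z \<in> ball z0 e" for z
  proof -
    have zD: "z \<in> D" using z e by blast
    then have "deriv Q z = - (2 powr (1 - z) / (z - 1)) * Q z"
      using E0[OF zD] by (simp add: E_def D_def field_simps add_eq_0_iff)
    then show ?thesis
      using holomorphic_derivI[OF Q D zD, of "ball z0 e"] g[OF z]
      by (auto intro!: derivative_eq_intros)
  qed
  then have "\<exists>c. \<forall>z\<in>ball z0 e. Q z * exp (g z) = c"
    by (intro has_field_derivative_zero_constant) auto
  then have Q0: "Q z = 0" if "z \<in> ball z0 e" for z
    using Qz0 that e(1)
    by (metis centre_in_ball exp_not_eq_zero mult_eq_0_iff)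
  have "Q 2 = 0"
  proof (rule analytic_continuation_open[OF open_ball D _ conn e(2) Q, of "\<lambda>_. 0"])
    show "ball z0 e \<noteq> {}" using e by auto
    show "2 \<in> D" by (simp add: D_def)
  qed (use Q0 in auto)
  moreover have "Q 2 \<noteq> 0" using Q_real[of 2] by simp
  ultimately show False by simp
qed

section \<open>Gamma integrals and partial fractions\<close>

lemma nn_integral_Gamma_scaled:
  fixes a y :: real
  assumes a: "0 < a" and y: "0 < y"
  shows "(\<integral>\<^sup>+t. ennreal (indicator {0<..} t * (t powr (a - 1) * exp (- (y * t)))) \<partial>lborel)
    = ennreal (Gamma a * y powr - a)"
proof -
  define I where "I = (\<integral>\<^sup>+t. ennreal (indicator {0<..} t * (t powr (a - 1) * exp (- (y * t)))) \<partial>lborel)"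
  have "ennreal (Gamma a) = ennreal y * (\<integral>\<^sup>+t. ennreal (indicator {0..} (0 + y * t) * (0 + y * t) powr (a - 1) / exp (0 + y * t)) \<partial>lborel)"
    unfolding Gamma_conv_nn_integral_real[OF a]
    using y by (subst nn_integral_real_affine[where c = y and t = 0]) simp_all
  also have "(\<integral>\<^sup>+t. ennreal (indicator {0..} (0 + y * t) * (0 + y * t) powr (a - 1) / exp (0 + y * t)) \<partial>lborel)
      = (\<integral>\<^sup>+t. ennreal (y powr (a - 1)) * ennreal (indicator {0<..} t * (t powr (a - 1) * exp (- (y * t)))) \<partial>lborel)"
  proof (rule nn_integral_cong)
    fix t :: real
    show "ennreal (indicator {0..} (0 + y * t) * (0 + y * t) powr (a - 1) / exp (0 + y * t))
      = ennreal (y powr (a - 1)) * ennreal (indicator {0<..} t * (t powr (a - 1) * exp (- (y * t))))"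
    proof (cases "0 < t")
      case True
      have "(y * t) powr (a - 1) / exp (y * t) = y powr (a - 1) * (t powr (a - 1) * exp (- (y * t)))"
        using True y by (simp add: powr_mult exp_minus field_simps)
      then show ?thesis using True y by (simp add: ennreal_mult'[symmetric])
    next
      case False
      then show ?thesis using y by (cases "t = 0") (auto simp: indicator_def zero_le_mult_iff)
    qed
  qed
  also have "\<dots> = ennreal (y powr (a - 1)) * I"
    unfolding I_def by (rule nn_integral_cmult) simp
  finally have "ennreal (Gamma a) = ennreal (y * y powr (a - 1)) * I"
    using y by (simp add: ennreal_mult' mult.assoc)
  also have "y * y powr (a - 1) = y powr a"
    using y powr_add[of y 1 "a - 1"] by simp
  finally have "ennreal (y powr - a) * ennreal (Gamma a) = (ennreal (y powr - a) * ennreal (y powr a)) * I"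
    by (simp only: mult.assoc)
  also have "ennreal (y powr - a) * ennreal (y powr a) = 1"
    using y by (simp add: ennreal_mult'[symmetric] flip: powr_add)
  finally show ?thesis using a y unfolding I_def[symmetric] by (simp add: ennreal_mult'[symmetric] mult.commute)
qed

text \<open>The classical integral for \<open>\<Gamma>(s) \<zeta>(s)\<close>, by the geometric series for \<open>1 / (exp t - 1)\<close>.\<close>
lemma has_bochner_integral_zeta:
  fixes s :: real
  assumes s: "1 < s"
  shows "has_bochner_integral lborel (\<lambda>t. indicator {0<..} t * (t powr (s - 1) * (1 / (exp t - 1))))
    (Gamma s * (\<Sum>n. real (Suc n) powr - s))"
proof (rule has_bochner_integral_nn_integral)
  have sm: "summable (\<lambda>n. Gamma s * real (Suc n) powr - s)"
    using s by (intro summable_mult summable_Suc_powr) simp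
  have pos: "0 \<le> Gamma s * real (Suc n) powr - s" for n
    using s by (simp add: Gamma_real_pos less_imp_le)
  have "(\<integral>\<^sup>+t. ennreal (indicator {0<..} t * (t powr (s - 1) * (1 / (exp t - 1)))) \<partial>lborel)
      = (\<integral>\<^sup>+t. (\<Sum>n. ennreal (indicator {0<..} t * (t powr (s - 1) * exp (- (real (Suc n) * t))))) \<partial>lborel)"
  proof (rule nn_integral_cong)
    fix t :: real
    show "ennreal (indicator {0<..} t * (t powr (s - 1) * (1 / (exp t - 1))))
      = (\<Sum>n. ennreal (indicator {0<..} t * (t powr (s - 1) * exp (- (real (Suc n) * t)))))"
    proof (cases "0 < t")
      case True
      have "(\<lambda>n. exp (- t) * exp (- t) ^ n) sums (exp (- t) * (1 / (1 - exp (- t))))"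
        using True by (intro sums_mult geometric_sums) simp
      moreover have "exp (- t) * exp (- t) ^ n = exp (- (real (Suc n) * t))" for n
        by (simp add: exp_of_nat_mult[symmetric] exp_add[symmetric] algebra_simps)
      moreover have "exp (- t) * (1 / (1 - exp (- t))) = 1 / (exp t - 1)"
        using True by (simp add: exp_minus field_simps)
      ultimately have "(\<lambda>n. t powr (s - 1) * exp (- (real (Suc n) * t))) sums (t powr (s - 1) * (1 / (exp t - 1)))"
        by (intro sums_mult) simp
      then show ?thesis using True
        by (subst suminf_ennreal_eq[where x = "t powr (s - 1) * (1 / (exp t - 1))"]) auto
    qed simp
  qed
  also have "\<dots> = (\<Sum>n. \<integral>\<^sup>+t. ennreal (indicator {0<..} t * (t powr (s - 1) * exp (- (real (Suc n) * t)))) \<partial>lborel)"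
    by (rule nn_integral_suminf) simp
  also have "\<dots> = (\<Sum>n. ennreal (Gamma s * real (Suc n) powr - s))"
    using s by (intro arg_cong[of _ _ suminf] ext nn_integral_Gamma_scaled) auto
  also have "\<dots> = ennreal (\<Sum>n. Gamma s * real (Suc n) powr - s)"
    by (rule suminf_ennreal2[OF pos sm])
  also have "(\<Sum>n. Gamma s * real (Suc n) powr - s) = Gamma s * (\<Sum>n. real (Suc n) powr - s)"
    using s by (intro suminf_mult summable_Suc_powr) simp
  finally show "(\<integral>\<^sup>+t. ennreal (indicator {0<..} t * (t powr (s - 1) * (1 / (exp t - 1)))) \<partial>lborel)
    = ennreal (Gamma s * (\<Sum>n. real (Suc n) powr - s))" .
  show "0 \<le> Gamma s * (\<Sum>n. real (Suc n) powr - s)"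
    using s by (intro mult_nonneg_nonneg suminf_nonneg summable_Suc_powr) (auto simp: Gamma_real_pos less_imp_le)
qed (auto simp: indicator_def)

text \<open>The logarithmic derivative of the reflection formula for the Gamma function expresses the
  cotangent by a difference of two Digamma values, whose series combine to the partial fractions.\<close>
lemma cot_partial_fractions:
  fixes z :: complex
  assumes z: "z \<notin> \<int>"
  shows "(\<lambda>n. 2 * z / (of_nat (Suc n) ^ 2 - z ^ 2)) sums (1 / z - of_real pi * cos (of_real pi * z) / sin (of_real pi * z))"
proof -
  let ?s = "\<lambda>w. sin (of_real pi * w) :: complex"
  have nI: "w \<notin> \<int>\<^sub>\<le>\<^sub>0" if "w \<notin> \<int>" for w :: complex using that nonpos_Ints_Int by blast
  have z1: "1 - z \<notin> \<int>" "1 + z \<notin> \<int>" using z Ints_diff[OF Ints_1, of "1 - z"] Ints_diff[OF _ Ints_1, of "1 + z"] by auto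
  have z0: "z \<noteq> 0" using z by auto
  have sin0: "?s z \<noteq> 0"
    using z by (auto simp: sin_eq_0 field_simps)
  have "((\<lambda>w. Gamma w * Gamma (1 - w)) has_field_derivative
      Gamma z * Gamma (1 - z) * (Digamma z - Digamma (1 - z))) (at z)"
    using nI[OF z] nI[OF z1(1)] by (auto intro!: derivative_eq_intros simp: algebra_simps)
  moreover have "((\<lambda>w. of_real pi / ?s w) has_field_derivative
      - (of_real pi * (of_real pi * cos (of_real pi * z))) / ?s z ^ 2) (at z)"
    using sin0 by (auto intro!: derivative_eq_intros simp: power2_eq_square)
  ultimately have Deq: "Gamma z * Gamma (1 - z) * (Digamma z - Digamma (1 - z)) = - (of_real pi * (of_real pi * cos (of_real pi * z))) / ?s z ^ 2"
    unfolding Gamma_reflection_complex by (rule DERIV_unique)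
  have D: "Digamma z - Digamma (1 - z) = - (of_real pi * cos (of_real pi * z)) / ?s z"
  proof -
    have quot: "d = - (p * c) / t" if "p / t * d = - (p * (p * c)) / t ^ 2" "p \<noteq> 0" "t \<noteq> 0" for p t d c :: complex
    proof -
      have "d = t / p * (p / t * d)" using that(2,3) by simp
      also have "\<dots> = - (p * c) / t" unfolding that(1) using that(2,3) by (simp add: power2_eq_square)
      finally show ?thesis .
    qed
    show ?thesis
      by (rule quot[OF Deq[unfolded Gamma_reflection_complex] _ sin0]) simp
  qed
  have ser: "(\<lambda>k. inverse (of_nat (Suc k)) - inverse (w + of_nat k)) sums (Digamma w + euler_mascheroni)"
    if "w \<notin> \<int>" for w :: complex
  proof -
    have "w \<noteq> 0" using that by auto
    then show ?thesis using summable_Digamma[of w] by (simp add: Digamma_def sums_iff)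
  qed
  have "(\<lambda>k. (inverse (of_nat (Suc k)) - inverse (1 + z + of_nat k)) - (inverse (of_nat (Suc k)) - inverse (1 - z + of_nat k)))
      sums ((Digamma (1 + z) + euler_mascheroni) - (Digamma (1 - z) + euler_mascheroni))"
    by (intro sums_diff ser z1)
  also have "(\<lambda>k. (inverse (of_nat (Suc k)) - inverse (1 + z + of_nat k)) - (inverse (of_nat (Suc k)) - inverse (1 - z + of_nat k)))
      = (\<lambda>n. 2 * z / (of_nat (Suc n) ^ 2 - z ^ 2))"
  proof
    fix k
    have "of_nat (Suc k) + z \<noteq> 0" "of_nat (Suc k) - z \<noteq> 0"
      using z by (metis Ints_minus Ints_of_nat add_eq_0_iff2 eq_iff_diff_eq_0 minus_minus)+
    then have "(a - inverse (of_nat (Suc k) + z)) - (a - inverse (of_nat (Suc k) - z))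
        = 2 * z / ((of_nat (Suc k) + z) * (of_nat (Suc k) - z))" for a
      by (simp del: of_nat_Suc add: field_simps)
    moreover have "of_nat (Suc k) ^ 2 - z ^ 2 = (of_nat (Suc k) + z) * (of_nat (Suc k) - z)"
      by (simp add: power2_eq_square algebra_simps)
    moreover have "1 + z + of_nat k = of_nat (Suc k) + z" "1 - z + of_nat k = of_nat (Suc k) - z" by simp_all
    ultimately show "(inverse (of_nat (Suc k)) - inverse (1 + z + of_nat k)) - (inverse (of_nat (Suc k)) - inverse (1 - z + of_nat k))
      = 2 * z / (of_nat (Suc k) ^ 2 - z ^ 2)"
      by (simp only:)
  qed
  also have "(Digamma (1 + z) + euler_mascheroni) - (Digamma (1 - z) + euler_mascheroni) = 1 / z + (Digamma z - Digamma (1 - z))"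
    using Digamma_plus1[OF z0] by (simp add: add.commute)
  finally show ?thesis unfolding D by simp
qed

text \<open>The cotangent expansion at the purely imaginary point \<open>\<i> * x / (2 * pi)\<close>. All terms are positive for
  \<open>x > 0\<close>, which shows that the sum is nonnegative and permits termwise integration.\<close>
lemma bose_partial_fractions:
  fixes x :: real
  assumes x: "0 < x"
  shows "(\<lambda>n. 2 * x / ((2 * pi * real (Suc n)) ^ 2 + x ^ 2)) sums (1 / (exp x - 1) - 1 / x + 1 / 2)"
proof -
  define y where "y = x / (2 * pi)"
  define z where "z = \<i> * of_real y"
  have y: "0 < y" using x by (simp add: y_def)
  have z: "z \<notin> \<int>" using y by (auto simp: z_def complex_is_Int_iff)
  \<comment> \<open>At an imaginary point the expansion is imaginary; this factor makes the terms real and turns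
    \<open>2 * z / (n ^ 2 - z ^ 2)\<close> into the terms of the claim.\<close>
  have "(\<lambda>n. - \<i> / (2 * of_real pi) * (2 * z / (of_nat (Suc n) ^ 2 - z ^ 2))) sums
      (- \<i> / (2 * of_real pi) * (1 / z - of_real pi * cos (of_real pi * z) / sin (of_real pi * z)))"
    by (rule sums_mult[OF cot_partial_fractions[OF z]])
  also have "(\<lambda>n. - \<i> / (2 * of_real pi) * (2 * z / (of_nat (Suc n) ^ 2 - z ^ 2)))
      = (\<lambda>n. of_real (2 * x / ((2 * pi * real (Suc n)) ^ 2 + x ^ 2)))"
  proof
    fix n
    have "of_nat (Suc n) ^ 2 - z ^ 2 = complex_of_real (real (Suc n) ^ 2 + y ^ 2)"
      by (simp add: z_def power_mult_distrib)
    moreover have "- \<i> / (2 * of_real pi) * (2 * z / w) = of_real (y / pi) / w" for w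
      by (simp add: z_def)
    moreover have "y / pi / (real (Suc n) ^ 2 + y ^ 2) = 2 * x / ((2 * pi * real (Suc n)) ^ 2 + x ^ 2)"
      by (simp add: y_def field_simps power2_eq_square del: of_nat_Suc)
    ultimately show "- \<i> / (2 * of_real pi) * (2 * z / (of_nat (Suc n) ^ 2 - z ^ 2))
        = of_real (2 * x / ((2 * pi * real (Suc n)) ^ 2 + x ^ 2))"
      by (metis of_real_divide)
  qed
  also have "- \<i> / (2 * of_real pi) * (1 / z - of_real pi * cos (of_real pi * z) / sin (of_real pi * z))
      = of_real (1 / (exp x - 1) - 1 / x + 1 / 2)"
  proof -
    define q where "q = exp (x / 2)"
    have q: "1 < q" "exp x = q ^ 2" using x by (simp_all add: q_def power2_eq_square flip: exp_add)
    have pz: "of_real pi * z = \<i> * of_real (x / 2)" by (simp add: z_def y_def)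
    have e: "exp (\<i> * (\<i> * of_real (x / 2))) = of_real (1 / q)" "exp (- (\<i> * (\<i> * of_real (x / 2)))) = of_real q"
      by (simp_all add: q_def exp_minus inverse_eq_divide flip: exp_of_real mult.assoc)
    have quot: "of_real p * of_real C / (of_real S / \<i>) = \<i> * of_real (p * C / S)" for p C S :: real
      by (simp only: divide_divide_eq_right of_real_mult of_real_divide times_divide_eq_right mult_ac)
    have cos: "cos (of_real pi * z) = of_real ((1 / q + q) / 2)"
      unfolding pz cos_exp_eq e by simp
    have sin: "sin (of_real pi * z) = of_real ((1 / q - q) / 2) / \<i>"
      unfolding pz sin_exp_eq e by simp
    have cot: "of_real pi * cos (of_real pi * z) / sin (of_real pi * z)
        = \<i> * of_real (pi * ((1 / q + q) / 2) / ((1 / q - q) / 2))"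
      unfolding cos sin by (rule quot)
    have inv: "1 / z = - \<i> * of_real (2 * pi / x)"
    proof -
      have "1 / z = inverse \<i> * inverse (of_real y)"
        by (simp only: z_def divide_inverse inverse_mult_distrib mult_1_left)
      then show ?thesis by (simp add: y_def)
    qed
    have alg: "- \<i> / (2 * of_real pi) * (- \<i> * of_real A - \<i> * of_real B) = of_real (- (1 / (2 * pi)) * (A + B))"
      for A B :: real by (simp add: field_simps)
    have "- \<i> / (2 * of_real pi) * (1 / z - of_real pi * cos (of_real pi * z) / sin (of_real pi * z))
        = of_real (- (1 / (2 * pi)) * (2 * pi / x + pi * ((1 / q + q) / 2) / ((1 / q - q) / 2)))"
      unfolding cot inv by (rule alg)
    also have "- (1 / (2 * pi)) * (2 * pi / x + pi * ((1 / q + q) / 2) / ((1 / q - q) / 2)) = 1 / (exp x - 1) - 1 / x + 1 / 2"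
    proof -
      have "1 < q * q" using q(1) less_1_mult by blast
      then have nz: "q \<noteq> 0" "q ^ 2 - 1 \<noteq> 0" "1 / q - q \<noteq> 0" using q by (auto simp: field_simps power2_eq_square)
      have "((1 / q + q) / 2) / ((1 / q - q) / 2) = - ((q ^ 2 + 1) / (q ^ 2 - 1))"
        using nz by (simp add: field_simps power2_eq_square)
      moreover have "(q ^ 2 + 1) / (q ^ 2 - 1) = 1 + 2 / (q ^ 2 - 1)"
        using nz by (simp add: field_simps)
      ultimately have "((1 / q + q) / 2) / ((1 / q - q) / 2) = - (1 + 2 / (q ^ 2 - 1))" by (simp only:)
      then have "pi * ((1 / q + q) / 2) / ((1 / q - q) / 2) = pi * - (1 + 2 / (q ^ 2 - 1))"
        by (simp only: times_divide_eq_right[symmetric])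
      then show ?thesis by (simp only: q(2)) (simp add: algebra_simps)
    qed
    finally show ?thesis .
  qed
  finally show ?thesis by (simp only: sums_of_real_iff)
qed

text \<open>The substitution \<open>v = t ^ 2\<close> reduces this to a scaled Gamma integral.\<close>
lemma nn_integral_Gamma_square:
  fixes s u :: real
  assumes s: "- 1 < s" and u: "0 < u"
  shows "(\<integral>\<^sup>+t. ennreal (indicator {0<..} t * (t powr s * exp (- (u * t ^ 2)))) \<partial>lborel)
    = ennreal (Gamma ((s + 1) / 2) / 2 * u powr - ((s + 1) / 2))"
proof -
  define a where "a = (s + 1) / 2"
  define f where "f = (\<lambda>v. v powr (a - 1) * exp (- (u * v)))"
  have a: "0 < a" using s by (simp add: a_def)
  have G: "0 \<le> Gamma a * u powr - a" using a by (simp add: Gamma_real_pos less_imp_le)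
  have "((\<lambda>v. indicator {0<..} v * f v) has_integral (Gamma a * u powr - a)) UNIV"
    using nn_integral_Gamma_scaled[OF a u] G
    by (intro nn_integral_has_integral) (auto simp: f_def indicator_def)
  moreover have "(\<lambda>v. indicator {0<..} v * f v) = (\<lambda>v. if v \<in> {0<..} then f v else 0)" by auto
  ultimately have f: "(f has_integral (Gamma a * u powr - a)) {0<..}"
    by (simp only: has_integral_restrict_UNIV)
  then have "f absolutely_integrable_on {0<..} \<and> integral {0<..} f = Gamma a * u powr - a"
    by (auto simp: absolutely_integrable_on_iff_nonneg f_def has_integral_iff)
  moreover have "(\<lambda>t::real. t ^ 2) ` {0<..} = {0<..}"
  proof (intro set_eqI iffI)
    fix v :: real assume "v \<in> {0<..}"
    then show "v \<in> (\<lambda>t. t ^ 2) ` {0<..}" by (intro image_eqI[of _ _ "sqrt v"]) auto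
  qed auto
  ultimately have "(\<lambda>t. \<bar>2 * t\<bar> * f (t ^ 2)) absolutely_integrable_on {0<..} \<and>
      integral {0<..} (\<lambda>t. \<bar>2 * t\<bar> * f (t ^ 2)) = Gamma a * u powr - a"
    by (subst has_absolute_integral_change_of_variables_1'[where g = "\<lambda>t. t ^ 2"])
      (auto intro!: derivative_eq_intros inj_onI simp: power2_eq_iff_nonneg)
  then have "((\<lambda>t. \<bar>2 * t\<bar> * f (t ^ 2)) has_integral (Gamma a * u powr - a)) {0<..}"
    using set_lebesgue_integral_eq_integral(1) has_integral_iff by blast
  then have "((\<lambda>t. \<bar>2 * t\<bar> * f (t ^ 2) / 2) has_integral (Gamma a * u powr - a) / 2) {0<..}"
    by (rule has_integral_divide)
  from nn_integral_has_integral_lebesgue[OF _ this]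
  have I: "(\<integral>\<^sup>+t. ennreal (indicator {0<..} t * (\<bar>2 * t\<bar> * f (t ^ 2) / 2)) \<partial>lborel) = ennreal ((Gamma a * u powr - a) / 2)"
    by (simp add: f_def)
  have eq: "indicator {0<..} t * (\<bar>2 * t\<bar> * f (t ^ 2) / 2) = indicator {0<..} t * (t powr s * exp (- (u * t ^ 2)))" for t
  proof (cases "0 < t")
    case True
    have "t * (t ^ 2) powr (a - 1) = t powr s"
    proof -
      have "(t ^ 2) powr (a - 1) = t powr (2 * (a - 1))"
        using True by (simp add: powr_powr flip: powr_numeral)
      moreover have "s = 1 + 2 * (a - 1)" by (simp add: a_def field_simps)
      ultimately show ?thesis using True by (simp only: powr_add powr_one)
    qed
    then show ?thesis using True by (simp add: f_def)
  qed simp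
  show ?thesis using I unfolding eq by (simp add: a_def)
qed

text \<open>Written as a Laplace transform, \<open>1 / (c ^ 2 + t ^ 2)\<close> is the integral of
  \<open>exp (- ((c ^ 2 + t ^ 2) * u))\<close> over \<open>u > 0\<close>; exchanging the integrals leaves two Gamma
  integrals.\<close>
lemma nn_integral_powr_over_squares:
  fixes s c :: real
  assumes s: "- 1 < s" "s < 1" and c: "0 < c"
  shows "(\<integral>\<^sup>+t. ennreal (indicator {0<..} t * (t powr s / (c ^ 2 + t ^ 2))) \<partial>lborel)
    = ennreal (Gamma ((1 + s) / 2) * Gamma ((1 - s) / 2) / 2 * c powr (s - 1))"
proof -
  define A where "A = Gamma ((1 + s) / 2) / 2"
  have A: "0 \<le> A" using s by (simp add: A_def Gamma_real_pos less_imp_le)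
  have "(\<integral>\<^sup>+t. ennreal (indicator {0<..} t * (t powr s / (c ^ 2 + t ^ 2))) \<partial>lborel)
      = (\<integral>\<^sup>+t. \<integral>\<^sup>+u. ennreal (indicator {0<..} t * t powr s * (indicator {0<..} u * exp (- ((c ^ 2 + t ^ 2) * u)))) \<partial>lborel \<partial>lborel)"
  proof (rule nn_integral_cong)
    fix t :: real
    have "0 < c ^ 2 + t ^ 2" using c by (simp add: add_pos_nonneg)
    note I = nn_integral_Gamma_scaled[of 1, OF zero_less_one this]
    have "(\<integral>\<^sup>+u. ennreal (indicator {0<..} u * exp (- ((c ^ 2 + t ^ 2) * u))) \<partial>lborel) = ennreal (1 / (c ^ 2 + t ^ 2))"
    proof -
      have "indicator {0<..} u * exp (- ((c ^ 2 + t ^ 2) * u))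
          = indicator {0<..} u * (u powr (1 - 1) * exp (- ((c ^ 2 + t ^ 2) * u)))" for u :: real
        by (cases "0 < u") simp_all
      then show ?thesis
        using I \<open>0 < c ^ 2 + t ^ 2\<close> by (simp only: Gamma_1 powr_minus powr_one_gt_zero_iff) (simp add: powr_minus_divide inverse_eq_divide)
    qed
    then show "ennreal (indicator {0<..} t * (t powr s / (c ^ 2 + t ^ 2)))
      = (\<integral>\<^sup>+u. ennreal (indicator {0<..} t * t powr s * (indicator {0<..} u * exp (- ((c ^ 2 + t ^ 2) * u)))) \<partial>lborel)"
      by (simp add: ennreal_mult' nn_integral_cmult) (simp add: ennreal_mult'[symmetric])
  qed
  also have "\<dots> = (\<integral>\<^sup>+u. \<integral>\<^sup>+t. ennreal (indicator {0<..} t * t powr s * (indicator {0<..} u * exp (- ((c ^ 2 + t ^ 2) * u)))) \<partial>lborel \<partial>lborel)"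
    by (rule lborel_pair.Fubini') (simp add: case_prod_unfold)
  also have "\<dots> = (\<integral>\<^sup>+u. ennreal A * ennreal (indicator {0<..} u * (u powr ((1 - s) / 2 - 1) * exp (- (c ^ 2 * u)))) \<partial>lborel)"
  proof (rule nn_integral_cong)
    fix u :: real
    show "(\<integral>\<^sup>+t. ennreal (indicator {0<..} t * t powr s * (indicator {0<..} u * exp (- ((c ^ 2 + t ^ 2) * u)))) \<partial>lborel)
      = ennreal A * ennreal (indicator {0<..} u * (u powr ((1 - s) / 2 - 1) * exp (- (c ^ 2 * u))))"
    proof (cases "0 < u")
      case True
      have "(\<integral>\<^sup>+t. ennreal (indicator {0<..} t * t powr s * (indicator {0<..} u * exp (- ((c ^ 2 + t ^ 2) * u)))) \<partial>lborel)
          = (\<integral>\<^sup>+t. ennreal (exp (- (c ^ 2 * u))) * ennreal (indicator {0<..} t * (t powr s * exp (- (u * t ^ 2)))) \<partial>lborel)"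
        using True by (intro nn_integral_cong) (simp add: ennreal_mult'[symmetric] algebra_simps flip: exp_add)
      also have "\<dots> = ennreal (exp (- (c ^ 2 * u))) * ennreal (A * u powr - ((s + 1) / 2))"
        using s True by (simp add: nn_integral_cmult nn_integral_Gamma_square A_def add.commute)
      also have "- ((s + 1) / 2) = (1 - s) / 2 - 1" by (simp add: field_simps)
      finally show ?thesis using True A by (simp add: ennreal_mult'[symmetric] mult_ac)
    qed simp
  qed
  also have "\<dots> = ennreal A * ennreal (Gamma ((1 - s) / 2) * (c ^ 2) powr - ((1 - s) / 2))"
    using s c by (simp add: nn_integral_cmult nn_integral_Gamma_scaled)
  also have "(c ^ 2) powr - ((1 - s) / 2) = c powr (s - 1)"
  proof -
    have "(c ^ 2) powr - ((1 - s) / 2) = c powr (2 * - ((1 - s) / 2))"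
      using c by (simp add: powr_powr flip: powr_numeral)
    also have "2 * - ((1 - s) / 2) = s - 1" by (simp add: field_simps)
    finally show ?thesis .
  qed
  finally show ?thesis using A by (simp add: ennreal_mult'[symmetric] A_def mult_ac)
qed

section \<open>The functional equation\<close>

text \<open>For \<open>-1 < s < 0\<close> the subtraction of the singular part at 0 makes the integral converge;
  its partial fractions integrate to multiples of \<open>real (Suc n) powr - (1 - s)\<close>, so the value
  \<open>\<zeta>(1 - s)\<close> appears.\<close>
lemma has_bochner_integral_zeta_left:
  fixes s :: real
  assumes s: "- 1 < s" "s < 0"
  shows "has_bochner_integral lborel (\<lambda>t. indicator {0<..} t * (t powr (s - 1) * (1 / (exp t - 1) - 1 / t + 1 / 2)))
    ((2 * pi) powr (s - 1) * Gamma ((1 + s) / 2) * Gamma ((1 - s) / 2) * (\<Sum>n. real (Suc n) powr - (1 - s)))"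
proof (rule has_bochner_integral_nn_integral)
  define g where "g = (\<lambda>t::real. 1 / (exp t - 1) - 1 / t + 1 / 2)"
  define c where "c = (\<lambda>n. 2 * pi * real (Suc n))"
  define K where "K = (2 * pi) powr (s - 1) * Gamma ((1 + s) / 2) * Gamma ((1 - s) / 2)"
  have c: "0 < c n" for n by (simp add: c_def)
  have K: "0 \<le> K" using s by (simp add: K_def Gamma_real_pos less_imp_le)
  have g: "(\<lambda>n. 2 * t / (c n ^ 2 + t ^ 2)) sums g t" if "0 < t" for t
    using bose_partial_fractions[OF that] by (simp only: c_def g_def)
  have g0: "0 \<le> g t" if "0 < t" for t
    by (rule sums_le[OF _ sums_zero g[OF that]]) (use that in simp)
  have "(\<integral>\<^sup>+t. ennreal (indicator {0<..} t * (t powr (s - 1) * g t)) \<partial>lborel)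
      = (\<integral>\<^sup>+t. (\<Sum>n. 2 * ennreal (indicator {0<..} t * (t powr s / (c n ^ 2 + t ^ 2)))) \<partial>lborel)"
  proof (rule nn_integral_cong)
    fix t :: real
    show "ennreal (indicator {0<..} t * (t powr (s - 1) * g t))
      = (\<Sum>n. 2 * ennreal (indicator {0<..} t * (t powr s / (c n ^ 2 + t ^ 2))))"
    proof (cases "0 < t")
      case True
      have eq: "t powr (s - 1) * (2 * t / w) = 2 * (t powr s / w)" for w
        using True powr_add[of t "s - 1" 1] by simp
      have *: "(\<lambda>n. 2 * (t powr s / (c n ^ 2 + t ^ 2))) sums (t powr (s - 1) * g t)"
        using sums_mult[OF g[OF True], of "t powr (s - 1)"] unfolding eq .
      have eq2: "2 * ennreal (t powr s / (c n ^ 2 + t ^ 2)) = ennreal (2 * (t powr s / (c n ^ 2 + t ^ 2)))" for n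
        by (subst ennreal_mult) auto
      have "(\<Sum>n. 2 * ennreal (t powr s / (c n ^ 2 + t ^ 2))) = ennreal (t powr (s - 1) * g t)"
        unfolding eq2 by (rule suminf_ennreal_eq[OF _ *]) simp
      then show ?thesis using True by simp
    qed simp
  qed
  also have "\<dots> = (\<Sum>n. \<integral>\<^sup>+t. 2 * ennreal (indicator {0<..} t * (t powr s / (c n ^ 2 + t ^ 2))) \<partial>lborel)"
    by (rule nn_integral_suminf) simp
  also have "\<dots> = (\<Sum>n. ennreal (K * real (Suc n) powr - (1 - s)))"
  proof (intro arg_cong[of _ _ suminf] ext)
    fix n
    have "(\<integral>\<^sup>+t. 2 * ennreal (indicator {0<..} t * (t powr s / (c n ^ 2 + t ^ 2))) \<partial>lborel)
        = 2 * (\<integral>\<^sup>+t. ennreal (indicator {0<..} t * (t powr s / (c n ^ 2 + t ^ 2))) \<partial>lborel)"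
      by (rule nn_integral_cmult) simp
    also have "\<dots> = ennreal 2 * ennreal (Gamma ((1 + s) / 2) * Gamma ((1 - s) / 2) / 2 * c n powr (s - 1))"
      using s nn_integral_powr_over_squares[of s "c n", OF _ _ c] by (simp only: ennreal_numeral)
    also have "\<dots> = ennreal (2 * (Gamma ((1 + s) / 2) * Gamma ((1 - s) / 2) / 2 * c n powr (s - 1)))"
      by (rule ennreal_mult'[symmetric]) simp
    also have "c n powr (s - 1) = (2 * pi) powr (s - 1) * real (Suc n) powr - (1 - s)"
      unfolding c_def by (subst powr_mult) auto
    finally show "(\<integral>\<^sup>+t. 2 * ennreal (indicator {0<..} t * (t powr s / (c n ^ 2 + t ^ 2))) \<partial>lborel)
        = ennreal (K * real (Suc n) powr - (1 - s))"
      by (simp add: K_def mult_ac)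
  qed
  also have "\<dots> = ennreal (\<Sum>n. K * real (Suc n) powr - (1 - s))"
    using s K by (intro suminf_ennreal2 summable_mult summable_Suc_powr) auto
  also have "(\<Sum>n. K * real (Suc n) powr - (1 - s)) = K * (\<Sum>n. real (Suc n) powr - (1 - s))"
    using s by (intro suminf_mult summable_Suc_powr) simp
  finally show "(\<integral>\<^sup>+t. ennreal (indicator {0<..} t * (t powr (s - 1) * (1 / (exp t - 1) - 1 / t + 1 / 2))) \<partial>lborel)
      = ennreal ((2 * pi) powr (s - 1) * Gamma ((1 + s) / 2) * Gamma ((1 - s) / 2) * (\<Sum>n. real (Suc n) powr - (1 - s)))"
    by (simp only: g_def K_def)
  show "0 \<le> (2 * pi) powr (s - 1) * Gamma ((1 + s) / 2) * Gamma ((1 - s) / 2) * (\<Sum>n. real (Suc n) powr - (1 - s))"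
    unfolding K_def[symmetric] using s K
    by (intro mult_nonneg_nonneg suminf_nonneg summable_Suc_powr) auto
  show "AE t in lborel. 0 \<le> indicator {0<..} t * (t powr (s - 1) * (1 / (exp t - 1) - 1 / t + 1 / 2))"
    by (rule AE_I2) (use g0 in \<open>auto simp: indicator_def g_def\<close>)
qed simp

lemma has_bochner_integral_powr_0_1:
  fixes a :: real
  assumes a: "- 1 < a"
  shows "has_bochner_integral lborel (\<lambda>t. indicator {0<..<1} t * t powr a) (1 / (a + 1))"
proof (rule has_bochner_integral_nn_integral)
  have "((\<lambda>t. t powr a) has_integral (1 / (a + 1))) {0<..<1}"
    using has_integral_powr_from_0[OF a, of 1] by (simp add: has_integral_Icc_iff_Ioo)
  from nn_integral_has_integral_lebesgue[OF _ this]
  show "(\<integral>\<^sup>+t. ennreal (indicator {0<..<1} t * t powr a) \<partial>lborel) = ennreal (1 / (a + 1))" by simp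
qed (use a in auto)

lemma has_bochner_integral_powr_1_inf:
  fixes a :: real
  assumes a: "a < - 1"
  shows "has_bochner_integral lborel (\<lambda>t. indicator {1..} t * t powr a) (- 1 / (a + 1))"
proof (rule has_bochner_integral_nn_integral)
  have "((\<lambda>t. t powr a) has_integral (- 1 / (a + 1))) {1..}"
    using has_integral_powr_to_inf[OF a, of 1] by simp
  from nn_integral_has_integral_lebesgue[OF _ this]
  show "(\<integral>\<^sup>+t. ennreal (indicator {1..} t * t powr a) \<partial>lborel) = ennreal (- 1 / (a + 1))" by simp
  show "0 \<le> - 1 / (a + 1)" using a by (simp add: divide_nonpos_neg)
qed auto

text \<open>Subtracting the singular part of \<open>1 / (exp t - 1)\<close> only on \<open>(0, 1)\<close> improves the behaviour at 0 and keeps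
  the exponential decay at infinity, so that one Mellin transform serves the whole half plane \<open>Re z > -1\<close>.\<close>
definition bose_kernel :: "real \<Rightarrow> real" where
  "bose_kernel t = (if t < 1 then 1 / (exp t - 1) - 1 / t + 1 / 2 else 1 / (exp t - 1))"

lemma bose_kernel_nonneg: "0 < t \<Longrightarrow> 0 \<le> bose_kernel t"
  using sums_le[OF _ sums_zero bose_partial_fractions[of t]] by (auto simp: bose_kernel_def)

lemma borel_measurable_bose_kernel [measurable]: "bose_kernel \<in> borel_measurable borel"
  unfolding bose_kernel_def[abs_def] by measurable

lemma has_bochner_integral_bose_right:
  fixes s :: real
  assumes s: "1 < s"
  shows "has_bochner_integral lborel (\<lambda>t. indicator {0<..} t * (t powr (s - 1) * bose_kernel t))
    (Gamma s * (\<Sum>n. real (Suc n) powr - s) - 1 / (s - 1) + 1 / (2 * s))"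
proof -
  have "has_bochner_integral lborel
      (\<lambda>t. indicator {0<..} t * (t powr (s - 1) * (1 / (exp t - 1))) - indicator {0<..<1} t * t powr (s - 2)
        + 1 / 2 * (indicator {0<..<1} t * t powr (s - 1)))
      (Gamma s * (\<Sum>n. real (Suc n) powr - s) - 1 / (s - 2 + 1) + 1 / 2 * (1 / (s - 1 + 1)))"
    using s by (intro has_bochner_integral_add has_bochner_integral_diff has_bochner_integral_mult_right
        has_bochner_integral_zeta has_bochner_integral_powr_0_1) auto
  moreover have "indicator {0<..} t * (t powr (s - 1) * (1 / (exp t - 1))) - indicator {0<..<1} t * t powr (s - 2)
        + 1 / 2 * (indicator {0<..<1} t * t powr (s - 1)) = indicator {0<..} t * (t powr (s - 1) * bose_kernel t)" for t :: real
  proof -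
    have "t powr (s - 1) / t = t powr (s - 2)" if "0 < t"
      using that powr_diff[of t "s - 1" 1] by simp
    then show ?thesis by (auto simp: indicator_def bose_kernel_def algebra_simps)
  qed
  ultimately show ?thesis by simp
qed

lemma has_bochner_integral_bose_left:
  fixes s :: real
  assumes s: "- 1 < s" "s < 0"
  shows "has_bochner_integral lborel (\<lambda>t. indicator {0<..} t * (t powr (s - 1) * bose_kernel t))
    ((2 * pi) powr (s - 1) * Gamma ((1 + s) / 2) * Gamma ((1 - s) / 2) * (\<Sum>n. real (Suc n) powr - (1 - s))
      - 1 / (s - 1) + 1 / (2 * s))"
proof -
  have "has_bochner_integral lborel
      (\<lambda>t. indicator {0<..} t * (t powr (s - 1) * (1 / (exp t - 1) - 1 / t + 1 / 2)) + indicator {1..} t * t powr (s - 2)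
        - 1 / 2 * (indicator {1..} t * t powr (s - 1)))
      ((2 * pi) powr (s - 1) * Gamma ((1 + s) / 2) * Gamma ((1 - s) / 2) * (\<Sum>n. real (Suc n) powr - (1 - s))
        + - 1 / (s - 2 + 1) - 1 / 2 * (- 1 / (s - 1 + 1)))"
    using s by (intro has_bochner_integral_add has_bochner_integral_diff has_bochner_integral_mult_right
        has_bochner_integral_zeta_left has_bochner_integral_powr_1_inf) auto
  moreover have "indicator {0<..} t * (t powr (s - 1) * (1 / (exp t - 1) - 1 / t + 1 / 2)) + indicator {1..} t * t powr (s - 2)
        - 1 / 2 * (indicator {1..} t * t powr (s - 1)) = indicator {0<..} t * (t powr (s - 1) * bose_kernel t)" for t :: real
  proof -
    have "t powr (s - 1) / t = t powr (s - 2)" if "0 < t"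
      using that powr_diff[of t "s - 1" 1] by simp
    then show ?thesis by (auto simp: indicator_def bose_kernel_def algebra_simps)
  qed
  ultimately show ?thesis by simp
qed

definition bose_mellin :: "complex \<Rightarrow> complex" where
  "bose_mellin z = (LINT t|lborel. indicator {0<..} t *\<^sub>R (of_real t powr (z - 1) * of_real (bose_kernel t)))"

lemma bose_mellin_of_real:
  "bose_mellin (of_real s) = of_real (LINT t|lborel. indicator {0<..} t * (t powr (s - 1) * bose_kernel t))"
proof -
  have "indicator {0<..} t *\<^sub>R (complex_of_real t powr (of_real s - 1) * of_real (bose_kernel t))
      = of_real (indicator {0<..} t * (t powr (s - 1) * bose_kernel t))" for t :: real
    by (cases "0 < t") (simp_all add: powr_of_real[of t "s - 1", simplified, symmetric])
  then show ?thesis unfolding bose_mellin_def by (simp only: integral_complex_of_real)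
qed

text \<open>On a small disc the kernel is dominated by the sum of the integrands for one exponent in \<open>(-1, 0)\<close>
  and one exponent above 1; both are already known to be integrable.\<close>
lemma bose_mellin_holomorphic: "bose_mellin holomorphic_on {z. - 1 < Re z}"
proof -
  define f where "f = (\<lambda>z t. indicator {0<..} t *\<^sub>R (complex_of_real t powr (z - 1) * of_real (bose_kernel t)))"
  have "(bose_mellin has_field_derivative (LINT t|lborel. deriv (\<lambda>z. f z t) z0)) (at z0)" if z0: "- 1 < Re z0" for z0
  proof -
    obtain a where a: "- 1 < a" "a < Re z0" "a < 0"
      using dense[of "- 1" "min 0 (Re z0)"] z0 by auto
    define b where "b = max 2 (Re z0 + 1)"
    define r where "r = min 1 (Re z0 - a)"
    define w where "w = (\<lambda>t. indicator {0<..} t * (t powr (a - 1) * bose_kernel t) + indicator {0<..} t * (t powr (b - 1) * bose_kernel t))"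
    have "((\<lambda>z. LINT t|lborel. f z t) has_field_derivative (LINT t|lborel. deriv (\<lambda>z. f z t) z0)) (at z0)"
    proof (rule has_field_derivative_integral)
      show "0 < r" using a by (simp add: r_def)
      show "(\<lambda>z. f z t) holomorphic_on ball z0 r" for t
        unfolding f_def by (cases "0 < t") (auto intro!: holomorphic_intros)
      show "f z \<in> borel_measurable lborel" for z
        unfolding f_def powr_def by measurable
      show "integrable lborel w"
        unfolding w_def using a
        by (intro Bochner_Integration.integrable_add integrable.intros[OF has_bochner_integral_bose_left]
            integrable.intros[OF has_bochner_integral_bose_right]) (auto simp: b_def)
      fix z t assume "z \<in> ball z0 r"
      then have "\<bar>Re (z0 - z)\<bar> < r"
        using abs_Re_le_cmod[of "z0 - z"] by (simp add: dist_norm)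
      then have z: "a \<le> Re z" "Re z \<le> b" by (auto simp: r_def b_def)
      show "norm (f z t) \<le> w t"
      proof (cases "0 < t")
        case True
        have "t powr (Re z - 1) \<le> t powr (a - 1) + t powr (b - 1)"
        proof (cases "t \<le> 1")
          case True
          then have "t powr (Re z - 1) \<le> t powr (a - 1)" using z \<open>0 < t\<close> by (intro powr_mono') auto
          then show ?thesis by (simp add: add_increasing2)
        next
          case False
          then have "t powr (Re z - 1) \<le> t powr (b - 1)" using z by (intro powr_mono) auto
          then show ?thesis by (simp add: add_increasing)
        qed
        then have "t powr (Re z - 1) * bose_kernel t \<le> (t powr (a - 1) + t powr (b - 1)) * bose_kernel t"
          using bose_kernel_nonneg[OF True] by (rule mult_right_mono)
        moreover have "norm (f z t) = t powr (Re z - 1) * bose_kernel t"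
          using True bose_kernel_nonneg[OF True] by (simp add: f_def norm_mult norm_powr_real_powr)
        ultimately show ?thesis using True by (simp add: w_def distrib_right)
      qed (simp add: f_def w_def)
    qed
    then show ?thesis by (simp add: bose_mellin_def[abs_def] f_def)
  qed
  then show ?thesis
    unfolding holomorphic_on_def field_differentiable_def
    using has_field_derivative_at_within by blast
qed

text \<open>The rational terms restore the Mellin integrals of the pieces \<open>1 / t\<close> and \<open>1 / 2\<close> by which the kernel was cut.\<close>
definition bose_continuation :: "complex \<Rightarrow> complex" where
  "bose_continuation z = bose_mellin z + 1 / (z - 1) - 1 / (2 * z)"

lemma bose_continuation_right:
  assumes s: "1 < s"
  shows "bose_continuation (of_real s) = Gamma (of_real s) * riemann_zeta (of_real s)"
proof -
  have "bose_mellin (of_real s) = of_real (Gamma s * (\<Sum>n. real (Suc n) powr - s) - 1 / (s - 1) + 1 / (2 * s))"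
    unfolding bose_mellin_of_real
    by (rule arg_cong[OF has_bochner_integral_integral_eq[OF has_bochner_integral_bose_right[OF s]]])
  then show ?thesis
    unfolding bose_continuation_def riemann_zeta_of_real[OF s] Gamma_complex_of_real by simp
qed

lemma bose_continuation_left:
  assumes s: "- 1 < s" "s < 0"
  shows "bose_continuation (of_real s) = (2 * of_real pi) powr (of_real s - 1) * Gamma ((1 + of_real s) / 2)
    * Gamma ((1 - of_real s) / 2) * riemann_zeta (1 - of_real s)"
proof -
  have "Gamma ((1 + of_real s) / 2) = complex_of_real (Gamma ((1 + s) / 2))"
    "Gamma ((1 - of_real s) / 2) = complex_of_real (Gamma ((1 - s) / 2))"
    using Gamma_complex_of_real[of "(1 + s) / 2"] Gamma_complex_of_real[of "(1 - s) / 2"] by simp_all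
  moreover have "(2 * of_real pi) powr (of_real s - 1) = complex_of_real ((2 * pi) powr (s - 1))"
    using powr_of_real[of "2 * pi" "s - 1"] by simp
  moreover have "riemann_zeta (1 - of_real s) = of_real (\<Sum>n. real (Suc n) powr - (1 - s))"
    using riemann_zeta_of_real[of "1 - s"] s by simp
  moreover have "bose_mellin (of_real s) = of_real ((2 * pi) powr (s - 1) * Gamma ((1 + s) / 2) * Gamma ((1 - s) / 2)
      * (\<Sum>n. real (Suc n) powr - (1 - s)) - 1 / (s - 1) + 1 / (2 * s))"
    unfolding bose_mellin_of_real
    using has_bochner_integral_integral_eq[OF has_bochner_integral_bose_left[OF s]] by simp
  ultimately show ?thesis by (simp add: bose_continuation_def)
qed

text \<open>One function, \<open>bose_continuation\<close>, is known on two real intervals: it is \<open>\<Gamma>(s) \<zeta>(s)\<close> for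
  \<open>s > 1\<close> and the right-hand side for \<open>-1 < s < 0\<close>. Each identity extends to the critical
  strip. The two domains of continuation omit the poles at 0 and 1, and at 0, respectively.\<close>
lemma zeta_functional_equation:
  assumes s: "0 < Re s" "Re s < 1"
  shows "Gamma s * riemann_zeta s
    = (2 * of_real pi) powr (s - 1) * Gamma ((1 + s) / 2) * Gamma ((1 - s) / 2) * riemann_zeta (1 - s)"
proof -
  define R where "R = (\<lambda>s. (2 * of_real pi) powr (s - 1) * Gamma ((1 + s) / 2) * Gamma ((1 - s) / 2) * riemann_zeta (1 - s))"
  define D where "D = {z. - 1 < Re z} - {0, 1::complex}"
  define S where "S = {z. - 1 < Re z} \<inter> {z. Re z < 1} - {0::complex}"
  have opD: "open D" unfolding D_def by (intro open_Diff open_halfspace_Re_gt) auto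
  have opS: "open S" unfolding S_def
    by (intro open_Diff open_Int open_halfspace_Re_gt open_halfspace_Re_lt) auto
  have cD: "connected D" unfolding D_def
    by (intro connected_open_diff_countable convex_connected convex_halfspace_Re_gt open_halfspace_Re_gt) auto
  have cS: "connected S" unfolding S_def
    by (intro connected_open_delete convex_connected convex_Int convex_halfspace_Re_gt convex_halfspace_Re_lt
        open_Int open_halfspace_Re_gt open_halfspace_Re_lt) auto
  have pos: "z \<notin> \<int>\<^sub>\<le>\<^sub>0" if "0 < Re z" for z
    using that by (auto elim!: nonpos_Ints_cases)
  have nonpole: "z \<notin> \<int>\<^sub>\<le>\<^sub>0" if "z \<in> D" for z
  proof
    assume "z \<in> \<int>\<^sub>\<le>\<^sub>0"
    then obtain n where "z = of_int n" "n \<le> 0" by (auto elim!: nonpos_Ints_cases)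
    with that show False by (cases "n = 0") (auto simp: D_def)
  qed
  have comp: "bose_continuation holomorphic_on D"
    unfolding bose_continuation_def[abs_def]
    by (intro holomorphic_intros holomorphic_on_subset[OF bose_mellin_holomorphic]) (auto simp: D_def)
  have holD: "(\<lambda>z. bose_continuation z - Gamma z * riemann_zeta z) holomorphic_on D"
    using nonpole
    by (intro holomorphic_intros comp holomorphic_on_subset[OF riemann_zeta_holomorphic]) (auto simp: D_def)
  have right: "bose_continuation z - Gamma z * riemann_zeta z = 0" if "z \<in> D" for z
  proof (rule analytic_continuation[OF holD opD cD, of "of_real ` {1<..}" 2])
    show "2 islimpt complex_of_real ` {1<..}"
      using of_real_islimpt_image[of "{1<..}" 2] by simp
  qed (use that bose_continuation_right in \<open>auto simp: D_def\<close>)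
  have "(\<lambda>z. riemann_zeta (1 - z)) holomorphic_on S"
  proof -
    have "(\<lambda>z. 1 - z) holomorphic_on S" "(\<lambda>z. 1 - z) ` S \<subseteq> - {1}"
      by (auto simp: S_def intro!: holomorphic_intros)
    from holomorphic_on_compose_gen[OF this(1) riemann_zeta_holomorphic this(2)]
    show ?thesis by (simp add: o_def)
  qed
  then have holR: "R holomorphic_on S"
    unfolding R_def by (intro holomorphic_intros) (auto intro!: pos simp: S_def)
  have "bose_continuation holomorphic_on S"
    by (rule holomorphic_on_subset[OF comp]) (auto simp: S_def D_def)
  with holR have holS: "(\<lambda>z. bose_continuation z - R z) holomorphic_on S" by (intro holomorphic_intros)
  have left: "bose_continuation z - R z = 0" if "z \<in> S" for z
  proof (rule analytic_continuation[OF holS opS cS, of "of_real ` {-1<..<0}" "of_real (- 1 / 2)"])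
    show "complex_of_real (- 1 / 2) islimpt of_real ` {- 1<..<0}"
      by (rule of_real_islimpt_image) auto
  qed (use that bose_continuation_left in \<open>auto simp: S_def R_def\<close>)
  have "s \<in> D" "s \<in> S" using s by (auto simp: D_def S_def)
  with left[of s] right[of s] show ?thesis by (simp add: R_def)
qed

section \<open>Zeros on the critical line\<close>

theorem mainTheorem2:
  assumes "\<exists>\<Theta>. \<Theta> holomorphic_on {z. Re z > 1/2} \<and> (\<forall>z. Re z > 1 \<longrightarrow> \<Theta> z = theta z)"
  shows "\<forall>z. nontrivial_zeta_zero z \<longrightarrow> Re z = 1/2"
proof (intro allI impI)
  fix z assume "nontrivial_zeta_zero z"
  then have z: "0 < Re z" "Re z < 1" "riemann_zeta z = 0" by (auto simp: nontrivial_zeta_zero_def)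
  obtain \<Theta> where \<Theta>: "\<Theta> holomorphic_on {z. Re z > 1/2}" "\<And>z. Re z > 1 \<Longrightarrow> \<Theta> z = theta z"
    using assms by blast
  have right: "riemann_zeta w \<noteq> 0" if "1/2 < Re w" "w \<noteq> 1" for w
    using zeta_no_zero_right[OF \<Theta>] that by blast
  have "z \<noteq> 1" using z(2) by auto
  then have "\<not> 1/2 < Re z" using right[of z] z(3) by blast
  moreover have "\<not> Re z < 1/2"
  proof
    assume "Re z < 1/2"
    then have "riemann_zeta (1 - z) \<noteq> 0" using z by (intro right) auto
    moreover have "Gamma ((1 + z) / 2) \<noteq> 0" "Gamma ((1 - z) / 2) \<noteq> 0"
      using z by (auto simp: Gamma_eq_zero_iff elim!: nonpos_Ints_cases dest!: arg_cong[of _ _ Re])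
    moreover have "(2 * complex_of_real pi) powr (z - 1) \<noteq> 0" by simp
    ultimately show False using zeta_functional_equation[of z] z by simp
  qed
  ultimately show "Re z = 1/2" by linarith
qed

end
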